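(* Let $\{f_n\}_{n=1}^\infty$ be a sequence of Lebesgue measurable functions on $[0,1]$ containing a subsequence $\{f_{n_k}\}$ such that: 1) $|f_{n_k}(x)|\le D$ for all $k$ and $x\in[0,1]$; 2) $f_{n_k}\to0$ weakly in $L_2[0,1]$; and 3') for every measurable $F\subset[0,1]$ with $|F|>0$, $\liminf_{k\to\infty}\int_F f_{n_k}^2(x)\,dx>0$. Then there exists a subsystem $\{\varphi_i\}_{i=1}^\infty\subset\{f_n\}$ such that for every segment $I\subset[0,1]$ with $|I|>0$ there is $k_0=k_0(I)\in\mathbb N$ for which $\{\varphi_i\chi_I\}_{i=k_0}^\infty$ (functions on $[0,1]$ with Lebesgue measure) is equivalent in distribution to the Rademacher system.
   Context: $|\cdot|$ denotes Lebesgue measure, $\chi_I$ the indicator of $I$. The Rademacher system is $r_n(x)=\operatorname{sign}\sin(2^{n-1}\pi x)$ on $[0,1]$. Equivalence in distribution of $\{f_n\}$ and $\{g_n\}$: there is $C>0$ such that for all $m$, real $a_1,\dots,a_m$ and $z>0$, $C^{-1}\mathbb P\{|\sum_{n=1}^m a_nf_n|>Cz\}\le\mathbb P'\{|\sum_{n=1}^m a_ng_n|>z\}\le C\,\mathbb P\{|\sum_{n=1}^m a_nf_n|>C^{-1}z\}$. *)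

theory Defs
  imports "HOL-Analysis.Analysis"
begin

definition tail01 :: "(real \<Rightarrow> real) \<Rightarrow> real \<Rightarrow> real" where
  "tail01 h z = measure lebesgue {x \<in> {0..1}. z < \<bar>h x\<bar>}"

text \<open>Rademacher system r_n(x) = sign sin(2^(n-1) pi x), n >= 1.\<close>
definition rademacher :: "nat \<Rightarrow> real \<Rightarrow> real" where
  "rademacher n x = sgn (sin (2 ^ (n - 1) * pi * x))"

definition equiv_distr :: "(nat \<Rightarrow> real \<Rightarrow> real) \<Rightarrow> (nat \<Rightarrow> real \<Rightarrow> real) \<Rightarrow> bool" where
  "equiv_distr f g \<longleftrightarrow> (\<exists>C>0. \<forall>m (a :: nat \<Rightarrow> real) (z::real). z > 0 \<longrightarrow>
      inverse C * tail01 (\<lambda>x. \<Sum>n<m. a n * f n x) (C * z)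
        \<le> tail01 (\<lambda>x. \<Sum>n<m. a n * g n x) z
    \<and> tail01 (\<lambda>x. \<Sum>n<m. a n * g n x) z
        \<le> C * tail01 (\<lambda>x. \<Sum>n<m. a n * f n x) (inverse C * z))"

end

(* Passing to a subsequence normalized by |u_k| \<le> 1, we may assume that u_k^2 has a weak limit tested
   against a countable family of functions, and that all integrals of u_n against Riesz products
   P_\<epsilon> = prod (1 + \<epsilon>_i u_i) of earlier terms are negligible. The measures P_\<epsilon> dx then couple the system
   with Rademacher signs: averaging R(\<epsilon>) = sum a_i \<epsilon>_i against P_\<epsilon> recovers X = sum a_i u_i, so Jensen's
   inequality bounds the moments of X by those of R, and testing X against the average of R^(p-1) P_\<epsilon>
   gives the converse on every interval where the weak limit of u_k^2 has positive integral.
   Since the moments of R satisfy E R^(2p) \<le> 4^p (E R^p)^2, moment equivalence with constants C^p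
   upgrades to equivalence of tails by the inequalities of Markov and Paley-Zygmund. *)

theory Submission
  imports Defs "HOL-Complex_Analysis.Great_Picard"
begin

text \<open>Nothing is known about the distribution of the \<open>u k\<close>, so the comparison
  runs through all even moments, with constants exponential in the exponent p, since the exponent
  that decides a tail depends on the level z. The two directions are not symmetric. The upper bound
  needs only the masses of the Riesz products over the whole interval. The lower bound needs the
  integral of u_i P_\<epsilon> over a segment to be close to \<epsilon>_i times a positive number
  independent of i. In P_\<epsilon> the factor 1 + \<epsilon>_i u_i does this: its 1 contributes
  little, and \<epsilon>_i u_i produces u_i^2 times the other factors. So the weak limit of the
  squares must itself hardly notice additional Riesz factors; this is the purpose of the Bessel-type
  argument. That limit is kept as a functional \<open>\<Lambda>\<close> on lists that code test
  functions. Errors form a geometric series and are made small against the limiting integral of the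
  squares over the segment by dropping initial terms, which is the origin of k0(I). The error at the
  i-th coefficient is absorbed by a_i^p \<le> E R^p.\<close>

section \<open>Moments of Rademacher sums\<close>

text \<open>The expectation over \<open>m\<close> independent fair signs, as a recursion that
  conditions on the last sign, so that identities become one-step inductions. Coordinates from
  \<open>m\<close> on keep the default value 1.\<close>

primrec rad_mean :: "nat \<Rightarrow> ((nat \<Rightarrow> real) \<Rightarrow> real) \<Rightarrow> real" where
  "rad_mean 0 F = F (\<lambda>_. 1)"
| "rad_mean (Suc m) F =
     (rad_mean m (\<lambda>\<epsilon>. F (\<epsilon>(m := 1))) + rad_mean m (\<lambda>\<epsilon>. F (\<epsilon>(m := -1)))) / 2"

definition signs :: "(nat \<Rightarrow> real) set" where
  "signs = {\<epsilon>. \<forall>i. \<epsilon> i = 1 \<or> \<epsilon> i = -1}"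

definition rad_sum :: "nat \<Rightarrow> (nat \<Rightarrow> real) \<Rightarrow> (nat \<Rightarrow> real) \<Rightarrow> real" where
  "rad_sum m a \<epsilon> = (\<Sum>i<m. a i * \<epsilon> i)"

definition riesz :: "nat \<Rightarrow> (nat \<Rightarrow> real) \<Rightarrow> (nat \<Rightarrow> real) \<Rightarrow> real" where
  "riesz m g \<epsilon> = (\<Prod>i<m. 1 + \<epsilon> i * g i)"

lemma signs_upd: "\<epsilon> \<in> signs \<Longrightarrow> y = 1 \<or> y = -1 \<Longrightarrow> \<epsilon>(m := y) \<in> signs"
  by (auto simp: signs_def)

lemma signs_one: "(\<lambda>_. 1) \<in> signs"
  by (simp add: signs_def)

lemma signs_abs: "\<epsilon> \<in> signs \<Longrightarrow> \<bar>\<epsilon> i\<bar> = 1"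
  by (auto simp: signs_def dest: spec[of _ i])

lemma rad_sum_upd [simp]: "rad_sum m a (\<epsilon>(m := y)) = rad_sum m a \<epsilon>"
  unfolding rad_sum_def by (rule sum.cong) auto

lemma rad_sum_Suc: "rad_sum (Suc m) a \<epsilon> = rad_sum m a \<epsilon> + a m * \<epsilon> m"
  by (simp add: rad_sum_def)

lemma riesz_upd [simp]: "riesz m g (\<epsilon>(m := y)) = riesz m g \<epsilon>"
  unfolding riesz_def by (rule prod.cong) auto

lemma riesz_Suc: "riesz (Suc m) g \<epsilon> = riesz m g \<epsilon> * (1 + \<epsilon> m * g m)"
  by (simp add: riesz_def)

lemma riesz_nonneg:
  assumes "\<epsilon> \<in> signs" "\<And>i. i < m \<Longrightarrow> \<bar>g i\<bar> \<le> 1"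
  shows "0 \<le> riesz m g \<epsilon>"
  unfolding riesz_def
proof (intro prod_nonneg ballI)
  fix i assume "i \<in> {..<m}"
  then have "\<bar>\<epsilon> i * g i\<bar> \<le> 1" using assms by (simp add: abs_mult signs_abs)
  then show "0 \<le> 1 + \<epsilon> i * g i" by linarith
qed

lemma rad_mean_mono:
  "(\<And>\<epsilon>. \<epsilon> \<in> signs \<Longrightarrow> F \<epsilon> \<le> G \<epsilon>) \<Longrightarrow> rad_mean m F \<le> rad_mean m G"
proof (induction m arbitrary: F G)
  case (Suc m)
  have "rad_mean m (\<lambda>\<epsilon>. F (\<epsilon>(m := y))) \<le> rad_mean m (\<lambda>\<epsilon>. G (\<epsilon>(m := y)))"
    if "y = 1 \<or> y = -1" for y
    using that by (intro Suc.IH Suc.prems signs_upd)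
  from this[of 1] this[of "-1"] show ?case by simp
qed (simp add: signs_one)

lemma rad_mean_cong:
  "(\<And>\<epsilon>. \<epsilon> \<in> signs \<Longrightarrow> F \<epsilon> = G \<epsilon>) \<Longrightarrow> rad_mean m F = rad_mean m G"
  by (intro antisym rad_mean_mono) simp_all

lemma rad_mean_add: "rad_mean m (\<lambda>\<epsilon>. F \<epsilon> + G \<epsilon>) = rad_mean m F + rad_mean m G"
  by (induction m arbitrary: F G) (simp_all add: field_simps)

lemma rad_mean_cmult: "rad_mean m (\<lambda>\<epsilon>. c * F \<epsilon>) = c * rad_mean m F"
  by (induction m arbitrary: F) (simp_all add: field_simps)

lemma rad_mean_const [simp]: "rad_mean m (\<lambda>\<epsilon>. c) = c"
  by (induction m) simp_all

lemma rad_mean_sum: "rad_mean m (\<lambda>\<epsilon>. \<Sum>i\<in>I. F i \<epsilon>) = (\<Sum>i\<in>I. rad_mean m (F i))"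
  by (induction I rule: infinite_finite_induct) (simp_all add: rad_mean_add)

lemma rad_mean_nonneg: "(\<And>\<epsilon>. \<epsilon> \<in> signs \<Longrightarrow> 0 \<le> F \<epsilon>) \<Longrightarrow> 0 \<le> rad_mean m F"
  using rad_mean_mono[of "\<lambda>_. 0" F m] by simp

lemma rad_mean_coeff:
  "i < m \<Longrightarrow> rad_mean m (\<lambda>\<epsilon>. \<epsilon> i * rad_sum m a \<epsilon>) = a i"
proof (induction m)
  case (Suc m)
  show ?case
  proof (cases "i = m")
    case True
    have "rad_mean (Suc m) (\<lambda>\<epsilon>. \<epsilon> i * rad_sum (Suc m) a \<epsilon>)
        = (rad_mean m (\<lambda>\<epsilon>. rad_sum m a \<epsilon> + a m) + rad_mean m (\<lambda>\<epsilon>. (-1) * rad_sum m a \<epsilon> + a m)) / 2"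
      using True by (simp add: rad_sum_Suc)
    also have "\<dots> = a i"
      unfolding rad_mean_add rad_mean_cmult using True by simp
    finally show ?thesis .
  next
    case False
    with Suc have *: "rad_mean m (\<lambda>\<epsilon>. \<epsilon> i * rad_sum m a \<epsilon>) = a i" by simp
    have "rad_mean (Suc m) (\<lambda>\<epsilon>. \<epsilon> i * rad_sum (Suc m) a \<epsilon>)
        = (rad_mean m (\<lambda>\<epsilon>. \<epsilon> i * rad_sum m a \<epsilon> + a m * \<epsilon> i)
           + rad_mean m (\<lambda>\<epsilon>. \<epsilon> i * rad_sum m a \<epsilon> + (- a m) * \<epsilon> i)) / 2"
      using False by (simp add: rad_sum_Suc algebra_simps)
    then show ?thesis
      unfolding rad_mean_add rad_mean_cmult using * by simp
  qed
qed simp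

text \<open>Each factor \<open>1 + \<epsilon> i * g i\<close> has mean 1 over its own sign. When
  \<open>\<bar>g i\<bar> \<le> 1\<close>, the Riesz product is thus a probability density on the
  sign cube, under which the signs are independent with means \<open>g i\<close>.\<close>

lemma rad_mean_riesz: "rad_mean m (riesz m g) = 1"
proof (induction m)
  case (Suc m)
  have "rad_mean (Suc m) (riesz (Suc m) g)
      = (rad_mean m (\<lambda>\<epsilon>. (1 + g m) * riesz m g \<epsilon>) + rad_mean m (\<lambda>\<epsilon>. (1 - g m) * riesz m g \<epsilon>)) / 2"
    by (simp add: riesz_Suc mult.commute)
  also have "\<dots> = 1"
    unfolding rad_mean_cmult Suc by simp
  finally show ?case .
qed (simp add: riesz_def)

lemma rad_mean_sum_riesz:
  "rad_mean m (\<lambda>\<epsilon>. rad_sum m a \<epsilon> * riesz m g \<epsilon>) = (\<Sum>i<m. a i * g i)"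
proof (induction m)
  case (Suc m)
  have "rad_mean (Suc m) (\<lambda>\<epsilon>. rad_sum (Suc m) a \<epsilon> * riesz (Suc m) g \<epsilon>)
      = (rad_mean m (\<lambda>\<epsilon>. (1 + g m) * (rad_sum m a \<epsilon> * riesz m g \<epsilon>) + (1 + g m) * a m * riesz m g \<epsilon>)
       + rad_mean m (\<lambda>\<epsilon>. (1 - g m) * (rad_sum m a \<epsilon> * riesz m g \<epsilon>) + (- (1 - g m) * a m) * riesz m g \<epsilon>)) / 2"
    by (simp add: riesz_Suc rad_sum_Suc algebra_simps)
  also have "\<dots> = (\<Sum>i<m. a i * g i) + g m * a m"
    unfolding rad_mean_add rad_mean_cmult Suc rad_mean_riesz by (simp add: algebra_simps)
  finally show ?case by simp
qed (simp add: rad_sum_def)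

text \<open>Supporting line of a convex function: averaged over \<open>y\<close> with mean
  \<open>x\<close>, its linear term vanishes, which is how Jensen's inequality is obtained in the
  next two lemmas.\<close>

lemma even_power_tangent:
  fixes x y :: real
  assumes "even p"
  shows "x ^ p + p * x ^ (p - 1) * (y - x) \<le> y ^ p"
proof -
  have "((\<lambda>x. x ^ p) has_real_derivative p * x ^ (p - 1)) (at x within UNIV)"
    by (rule derivative_eq_intros | simp)+
  then have "y ^ p - x ^ p \<ge> p * x ^ (p - 1) * (y - x)"
    by (intro convex_on_imp_above_tangent[OF convex_power_even[OF assms]]) auto
  then show ?thesis by simp
qed

text \<open>Jensen's inequality for the probability weights given by the Riesz product.\<close>
lemma sum_power_le_rad_mean:
  assumes "even p" "\<And>i. i < m \<Longrightarrow> \<bar>g i\<bar> \<le> 1"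
  shows "(\<Sum>i<m. a i * g i) ^ p \<le> rad_mean m (\<lambda>\<epsilon>. rad_sum m a \<epsilon> ^ p * riesz m g \<epsilon>)"
proof -
  define x where "x = (\<Sum>i<m. a i * g i)"
  define d where "d = real p * x ^ (p - 1)"
  have "x ^ p = rad_mean m (\<lambda>\<epsilon>. (x ^ p - d * x) * riesz m g \<epsilon> + d * (rad_sum m a \<epsilon> * riesz m g \<epsilon>))"
    unfolding rad_mean_add rad_mean_cmult rad_mean_riesz rad_mean_sum_riesz by (simp add: x_def)
  also have "\<dots> \<le> rad_mean m (\<lambda>\<epsilon>. rad_sum m a \<epsilon> ^ p * riesz m g \<epsilon>)"
  proof (intro rad_mean_mono)
    fix \<epsilon> assume e: "\<epsilon> \<in> signs"
    have "(x ^ p + d * (rad_sum m a \<epsilon> - x)) * riesz m g \<epsilon> \<le> rad_sum m a \<epsilon> ^ p * riesz m g \<epsilon>"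
      unfolding d_def
      by (intro mult_right_mono even_power_tangent assms riesz_nonneg e)
    then show "(x ^ p - d * x) * riesz m g \<epsilon> + d * (rad_sum m a \<epsilon> * riesz m g \<epsilon>)
        \<le> rad_sum m a \<epsilon> ^ p * riesz m g \<epsilon>"
      by (simp add: algebra_simps)
  qed
  finally show ?thesis unfolding x_def .
qed

text \<open>Jensen's inequality again: \<open>a i\<close> is the mean of
  \<open>\<epsilon> i * rad_sum m a \<epsilon>\<close>, and the sign disappears in an even power. It
  absorbs coefficient errors in \<open>rad_mean_le_moment\<close>.\<close>

lemma coeff_power_le_rad_mean:
  assumes "even p" "i < m"
  shows "a i ^ p \<le> rad_mean m (\<lambda>\<epsilon>. rad_sum m a \<epsilon> ^ p)"
proof -
  define d where "d = real p * a i ^ (p - 1)"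
  have "a i ^ p = rad_mean m (\<lambda>\<epsilon>. (a i ^ p - d * a i) + d * (\<epsilon> i * rad_sum m a \<epsilon>))"
    unfolding rad_mean_add rad_mean_cmult rad_mean_coeff[OF assms(2)] by simp
  also have "\<dots> \<le> rad_mean m (\<lambda>\<epsilon>. rad_sum m a \<epsilon> ^ p)"
  proof (intro rad_mean_mono)
    fix \<epsilon> assume e: "\<epsilon> \<in> signs"
    have "a i ^ p + d * (\<epsilon> i * rad_sum m a \<epsilon> - a i) \<le> (\<epsilon> i * rad_sum m a \<epsilon>) ^ p"
      unfolding d_def by (rule even_power_tangent[OF assms(1)])
    also have "\<dots> = rad_sum m a \<epsilon> ^ p"
      using power_even_abs[OF assms(1), of "\<epsilon> i * rad_sum m a \<epsilon>"] power_even_abs[OF assms(1), of "rad_sum m a \<epsilon>"]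
      by (simp add: abs_mult signs_abs[OF e])
    finally show "(a i ^ p - d * a i) + d * (\<epsilon> i * rad_sum m a \<epsilon>) \<le> rad_sum m a \<epsilon> ^ p"
      by (simp add: algebra_simps)
  qed
  finally show ?thesis .
qed

section \<open>Even moments of Rademacher sums and the doubling inequality\<close>

lemma sum_even_index:
  fixes f :: "nat \<Rightarrow> real"
  assumes "\<And>k. odd k \<Longrightarrow> f k = 0"
  shows "(\<Sum>k\<le>2*q. f k) = (\<Sum>j\<le>q. f (2*j))"
  by (induction q) (simp_all add: assms)

text \<open>Division by factorials turns the binomial theorem into a Cauchy product.\<close>

lemma power_add_over_fact:
  fixes x y :: real
  shows "(x + y) ^ n / fact n = (\<Sum>k\<le>n. x ^ (n - k) / fact (n - k) * (y ^ k / fact k))"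
proof -
  have "(x + y) ^ n / fact n = (\<Sum>k\<le>n. of_nat (n choose k) * y ^ k * x ^ (n - k)) / fact n"
    using binomial_ring[of y x n] by (simp add: add.commute)
  also have "\<dots> = (\<Sum>k\<le>n. x ^ (n - k) / fact (n - k) * (y ^ k / fact k))"
    unfolding sum_divide_distrib
  proof (rule sum.cong)
    fix k assume "k \<in> {..n}"
    then have "(of_nat (n choose k) :: real) = fact n / (fact k * fact (n - k))"
      by (intro binomial_fact) simp
    then show "of_nat (n choose k) * y ^ k * x ^ (n - k) / fact n = x ^ (n - k) / fact (n - k) * (y ^ k / fact k)"
      by (simp add: mult.commute)
  qed simp
  finally show ?thesis .
qed

lemma symmetrized_power_over_fact:
  fixes x y :: real
  shows "((x + y) ^ (2*q) + (x - y) ^ (2*q)) / (2 * fact (2*q))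
    = (\<Sum>j\<le>q. x ^ (2*(q - j)) / fact (2*(q - j)) * (y ^ (2*j) / fact (2*j)))"
proof -
  have "((x + y) ^ (2*q) + (x + (-y)) ^ (2*q)) / (2 * fact (2*q))
      = ((x + y) ^ (2*q) / fact (2*q) + (x + (-y)) ^ (2*q) / fact (2*q)) / 2"
    by (simp add: field_simps)
  also have "\<dots> = (\<Sum>k\<le>2*q. x ^ (2*q - k) / fact (2*q - k) * (((y ^ k + (-y) ^ k) / 2) / fact k))"
    unfolding power_add_over_fact sum.distrib[symmetric] sum_divide_distrib
    by (rule sum.cong) (simp_all add: field_simps)
  also have "\<dots> = (\<Sum>j\<le>q. x ^ (2*q - 2*j) / fact (2*q - 2*j) * (((y ^ (2*j) + (-y) ^ (2*j)) / 2) / fact (2*j)))"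
    by (rule sum_even_index) simp
  finally show ?thesis by (simp add: right_diff_distrib')
qed

text \<open>The coefficient of \<open>t ^ (2*q)\<close> in the moment generating function, which is
  the product of the \<open>cosh (a i * t)\<close> over \<open>i < m\<close>; passing from
  \<open>m\<close> to \<open>Suc m\<close> is therefore a Cauchy product.\<close>

definition rad_moment :: "nat \<Rightarrow> (nat \<Rightarrow> real) \<Rightarrow> nat \<Rightarrow> real" where
  "rad_moment m a q = rad_mean m (\<lambda>\<epsilon>. rad_sum m a \<epsilon> ^ (2*q)) / fact (2*q)"

lemma rad_moment_Suc:
  "rad_moment (Suc m) a q = (\<Sum>j\<le>q. rad_moment m a (q - j) * (a m ^ (2*j) / fact (2*j)))"
proof -
  have "rad_moment (Suc m) a q = 1 / (2 * fact (2*q)) * (rad_mean m (\<lambda>\<epsilon>. (rad_sum m a \<epsilon> + a m) ^ (2*q))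
      + rad_mean m (\<lambda>\<epsilon>. (rad_sum m a \<epsilon> - a m) ^ (2*q)))"
    by (simp add: rad_moment_def rad_sum_Suc)
  also have "\<dots> = rad_mean m (\<lambda>\<epsilon>. ((rad_sum m a \<epsilon> + a m) ^ (2*q) + (rad_sum m a \<epsilon> - a m) ^ (2*q)) / (2 * fact (2*q)))"
    unfolding rad_mean_add[symmetric] rad_mean_cmult[symmetric] by simp
  also have "\<dots> = rad_mean m (\<lambda>\<epsilon>. \<Sum>j\<le>q. (1 / fact (2*(q - j)) * (a m ^ (2*j) / fact (2*j))) * rad_sum m a \<epsilon> ^ (2*(q - j)))"
    unfolding symmetrized_power_over_fact by (simp add: field_simps)
  also have "\<dots> = (\<Sum>j\<le>q. rad_moment m a (q - j) * (a m ^ (2*j) / fact (2*j)))"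
    unfolding rad_mean_sum rad_mean_cmult by (simp add: rad_moment_def field_simps)
  finally show ?thesis .
qed

lemma rad_moment_nonneg: "0 \<le> rad_moment m a q"
  unfolding rad_moment_def by (intro divide_nonneg_nonneg rad_mean_nonneg) simp_all

text \<open>In terms of coefficients, the normalized moment of order \<open>2q\<close> is the sum of the terms
  \<open>a\<^sup>2\<^sup>\<alpha> / (2\<alpha>)!\<close> over multi-indices \<open>\<alpha>\<close> of weight \<open>q\<close>; each multi-index of weight \<open>s + t\<close> splits into
  two of weights \<open>s\<close> and \<open>t\<close>, and factorials are supermultiplicative.\<close>
lemma rad_moment_add_le:
  "rad_moment m a (s + t) \<le> rad_moment m a s * rad_moment m a t"
proof (induction m arbitrary: s t)
  case 0
  then show ?case by (cases s; cases t) (simp_all add: rad_moment_def rad_sum_def)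
next
  case (Suc m)
  define c where "c j = a m ^ (2*j) / fact (2*j)" for j
  let ?M = "rad_moment m a"
  have c0: "0 \<le> c j" for j unfolding c_def by simp
  have c_add: "c (i + k) \<le> c i * c k" for i k
  proof -
    have "fact (2*i) * fact (2*k) \<le> (fact (2*i + 2*k) :: real)"
    proof -
      have "fact (2*i) * fact (2*k) \<le> (fact (2*i + 2*k) :: nat)"
        by (intro dvd_imp_le fact_fact_dvd_fact) simp
      then have "real (fact (2*i) * fact (2*k)) \<le> real (fact (2*i + 2*k))"
        by (simp only: of_nat_le_iff)
      then show ?thesis by simp
    qed
    then have "a m ^ (2*i + 2*k) / fact (2*i + 2*k) \<le> a m ^ (2*i + 2*k) / (fact (2*i) * fact (2*k))"
      by (intro divide_left_mono) (auto simp: power_add)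
    then show ?thesis by (simp add: c_def power_add distrib_left)
  qed
  have "rad_moment (Suc m) a (s + t) = (\<Sum>j\<le>s+t. ?M (s + t - j) * c j)"
    by (simp add: rad_moment_Suc c_def)
  also have "\<dots> \<le> (\<Sum>j\<le>s+t. \<Sum>z\<in>{z \<in> {..s} \<times> {..t}. fst z + snd z = j}. ?M (s - fst z) * c (fst z) * (?M (t - snd z) * c (snd z)))"
  proof (intro sum_mono)
    fix j assume j: "j \<in> {..s+t}"
    \<comment> \<open>One term of the double sum with \<open>fst z + snd z = j\<close> is enough, as
      all are nonnegative. The split gives as much of \<open>j\<close> as possible to the first
      index; the rest is at most \<open>t\<close>.\<close>
    define i where "i = min s j"
    define k where "k = j - i"
    have ik: "i \<le> s" "k \<le> t" "i + k = j" using j by (auto simp: i_def k_def min_def)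
    have "?M (s + t - j) * c j = ?M ((s - i) + (t - k)) * c (i + k)"
      using ik by simp
    also have "\<dots> \<le> (?M (s - i) * ?M (t - k)) * (c i * c k)"
      by (intro mult_mono Suc.IH c_add c0 mult_nonneg_nonneg rad_moment_nonneg)
    also have "\<dots> = (\<Sum>z\<in>{(i,k)}. ?M (s - fst z) * c (fst z) * (?M (t - snd z) * c (snd z)))"
      by simp
    also have "\<dots> \<le> (\<Sum>z\<in>{z \<in> {..s} \<times> {..t}. fst z + snd z = j}. ?M (s - fst z) * c (fst z) * (?M (t - snd z) * c (snd z)))"
      using ik by (intro sum_mono2 mult_nonneg_nonneg rad_moment_nonneg c0) auto
    finally show "?M (s + t - j) * c j \<le> \<dots>" .
  qed
  also have "\<dots> = (\<Sum>z\<in>{..s} \<times> {..t}. ?M (s - fst z) * c (fst z) * (?M (t - snd z) * c (snd z)))"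
    by (rule sum.group) auto
  also have "\<dots> = (\<Sum>i\<le>s. ?M (s - i) * c i) * (\<Sum>k\<le>t. ?M (t - k) * c k)"
    by (simp add: sum_product sum.cartesian_product case_prod_beta)
  also have "\<dots> = rad_moment (Suc m) a s * rad_moment (Suc m) a t"
    by (simp add: rad_moment_Suc c_def)
  finally show ?case .
qed

text \<open>The case \<open>s = t = p / 2\<close> of \<open>rad_moment_add_le\<close>; undoing the
  normalization leaves the central binomial coefficient, at most \<open>4 ^ p\<close>.\<close>

lemma rad_mean_doubling:
  assumes "even p"
  shows "rad_mean m (\<lambda>\<epsilon>. rad_sum m a \<epsilon> ^ (2*p)) \<le> 4 ^ p * (rad_mean m (\<lambda>\<epsilon>. rad_sum m a \<epsilon> ^ p))\<^sup>2"
proof -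
  obtain s where p: "p = 2 * s" using assms by blast
  have "real (2*p choose p) = fact (2*p) / (fact p * fact p)"
    using binomial_fact[of p "2*p", where 'a=real] by simp
  moreover have "real (2*p choose p) \<le> 4 ^ p"
  proof -
    have "(2*p choose p) \<le> (\<Sum>k\<le>2*p. (2*p choose k))"
      by (rule member_le_sum) auto
    then have "(2*p choose p) \<le> 4 ^ p" by (simp add: choose_row_sum power_mult)
    then have "real (2*p choose p) \<le> real (4 ^ p)" by (simp only: of_nat_le_iff)
    then show ?thesis by simp
  qed
  ultimately have le: "fact (2*p) / (fact p * fact p) \<le> (4 ^ p :: real)" by simp
  have "rad_mean m (\<lambda>\<epsilon>. rad_sum m a \<epsilon> ^ (2*p)) = fact (2*p) * rad_moment m a (s + s)"
    by (simp add: rad_moment_def p)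
  also have "\<dots> \<le> fact (2*p) * (rad_moment m a s * rad_moment m a s)"
    by (intro mult_left_mono rad_moment_add_le) simp
  also have "\<dots> = fact (2*p) / (fact p * fact p) * (rad_mean m (\<lambda>\<epsilon>. rad_sum m a \<epsilon> ^ p))\<^sup>2"
    by (simp add: rad_moment_def p power2_eq_square)
  also have "\<dots> \<le> 4 ^ p * (rad_mean m (\<lambda>\<epsilon>. rad_sum m a \<epsilon> ^ p))\<^sup>2"
    by (intro mult_right_mono le) simp
  finally show ?thesis .
qed

section \<open>Comparison of moments and tails\<close>

text \<open>A class closed under sums, products and powers and contained in the integrable functions
  of any finite measure, so that integrability obligations reduce to structural rules.\<close>

definition bdd_meas :: "'a measure \<Rightarrow> ('a \<Rightarrow> real) \<Rightarrow> bool" where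
  "bdd_meas M f \<longleftrightarrow> f \<in> borel_measurable M \<and> (\<exists>B. \<forall>x\<in>space M. \<bar>f x\<bar> \<le> B)"

lemma bdd_measI:
  "f \<in> borel_measurable M \<Longrightarrow> (\<And>x. x \<in> space M \<Longrightarrow> \<bar>f x\<bar> \<le> B) \<Longrightarrow> bdd_meas M f"
  by (auto simp: bdd_meas_def)

lemma bdd_meas_measurable: "bdd_meas M f \<Longrightarrow> f \<in> borel_measurable M"
  by (simp add: bdd_meas_def)

lemma bdd_meas_const [simp]: "bdd_meas M (\<lambda>x. c)"
  by (intro bdd_measI[where B="\<bar>c\<bar>"]) auto

lemma bdd_meas_indicator: "A \<in> sets M \<Longrightarrow> bdd_meas M (indicator A)"
  by (intro bdd_measI[where B=1]) (auto simp: indicator_def)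

lemma bdd_meas_add:
  assumes "bdd_meas M f" "bdd_meas M g"
  shows "bdd_meas M (\<lambda>x. f x + g x)"
proof -
  obtain B C where "\<forall>x\<in>space M. \<bar>f x\<bar> \<le> B" "\<forall>x\<in>space M. \<bar>g x\<bar> \<le> C"
    using assms by (auto simp: bdd_meas_def)
  then have "\<bar>f x + g x\<bar> \<le> B + C" if "x \<in> space M" for x
    using that by (intro order_trans[OF abs_triangle_ineq add_mono]) auto
  then show ?thesis
    using assms by (intro bdd_measI) (auto simp: bdd_meas_def)
qed

lemma bdd_meas_mult:
  assumes "bdd_meas M f" "bdd_meas M g"
  shows "bdd_meas M (\<lambda>x. f x * g x)"
proof -
  obtain B C where "\<forall>x\<in>space M. \<bar>f x\<bar> \<le> B" "\<forall>x\<in>space M. \<bar>g x\<bar> \<le> C"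
    using assms by (auto simp: bdd_meas_def)
  then have "\<bar>f x * g x\<bar> \<le> B * C" if "x \<in> space M" for x
    using that unfolding abs_mult by (intro mult_mono) (auto intro: order_trans[OF abs_ge_zero])
  then show ?thesis
    using assms by (intro bdd_measI) (auto simp: bdd_meas_def)
qed

lemma bdd_meas_power: "bdd_meas M f \<Longrightarrow> bdd_meas M (\<lambda>x. f x ^ n)"
  by (induction n) (simp_all add: bdd_meas_mult)

lemma bdd_meas_sum: "(\<And>i. i \<in> I \<Longrightarrow> bdd_meas M (f i)) \<Longrightarrow> bdd_meas M (\<lambda>x. \<Sum>i\<in>I. f i x)"
  by (induction I rule: infinite_finite_induct) (simp_all add: bdd_meas_add)

lemma bdd_meas_prod: "(\<And>i. i \<in> I \<Longrightarrow> bdd_meas M (f i)) \<Longrightarrow> bdd_meas M (\<lambda>x. \<Prod>i\<in>I. f i x)"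
  by (induction I rule: infinite_finite_induct) (simp_all add: bdd_meas_mult)

lemma bdd_meas_abs: "bdd_meas M f \<Longrightarrow> bdd_meas M (\<lambda>x. \<bar>f x\<bar>)"
  by (auto simp: bdd_meas_def)

lemmas bdd_meas_intros =
  bdd_meas_const bdd_meas_indicator bdd_meas_add bdd_meas_mult bdd_meas_power
  bdd_meas_sum bdd_meas_prod bdd_meas_abs

lemma bdd_meas_riesz:
  "(\<And>i. i < m \<Longrightarrow> bdd_meas M (g i)) \<Longrightarrow> bdd_meas M (\<lambda>x. riesz m (\<lambda>i. g i x) \<epsilon>)"
  unfolding riesz_def by (intro bdd_meas_prod bdd_meas_add bdd_meas_mult bdd_meas_const) simp

lemma integrable_rad_mean:
  "(\<And>\<epsilon>. \<epsilon> \<in> signs \<Longrightarrow> integrable M (F \<epsilon>)) \<Longrightarrow> integrable M (\<lambda>x. rad_mean m (\<lambda>\<epsilon>. F \<epsilon> x))"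
proof (induction m arbitrary: F)
  case (Suc m)
  then have "integrable M (\<lambda>x. rad_mean m (\<lambda>\<epsilon>. F (\<epsilon>(m := y)) x))" if "y = 1 \<or> y = -1" for y
    using that by (intro Suc.IH Suc.prems signs_upd)
  then show ?case by simp
qed (simp add: signs_one)

lemma integral_rad_mean:
  "(\<And>\<epsilon>. \<epsilon> \<in> signs \<Longrightarrow> integrable M (F \<epsilon>)) \<Longrightarrow>
    (\<integral>x. rad_mean m (\<lambda>\<epsilon>. F \<epsilon> x) \<partial>M) = rad_mean m (\<lambda>\<epsilon>. \<integral>x. F \<epsilon> x \<partial>M)"
proof (induction m arbitrary: F)
  case (Suc m)
  have *: "(\<integral>x. rad_mean m (\<lambda>\<epsilon>. F (\<epsilon>(m := y)) x) \<partial>M) = rad_mean m (\<lambda>\<epsilon>. \<integral>x. F (\<epsilon>(m := y)) x \<partial>M)"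
    if "y = 1 \<or> y = -1" for y
    using that by (intro Suc.IH Suc.prems signs_upd)
  have **: "integrable M (\<lambda>x. rad_mean m (\<lambda>\<epsilon>. F (\<epsilon>(m := y)) x))" if "y = 1 \<or> y = -1" for y
    using that by (intro integrable_rad_mean Suc.prems signs_upd)
  show ?case using *[of 1] *[of "-1"] **[of 1] **[of "-1"] by simp
qed simp

section \<open>Inequalities of Markov and Paley-Zygmund\<close>

context finite_measure
begin

lemma bdd_meas_integrable: "bdd_meas M f \<Longrightarrow> integrable M f"
  unfolding bdd_meas_def by (elim conjE exE, rule integrable_const_bound) auto

lemma bdd_meas_tail:
  "bdd_meas M f \<Longrightarrow> {x \<in> space M. z < \<bar>f x\<bar>} \<in> sets M"
proof -
  assume "bdd_meas M f"
  then have [measurable]: "f \<in> borel_measurable M" by (rule bdd_meas_measurable)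
  show ?thesis by measurable
qed

lemma markov_even_power:
  assumes f: "bdd_meas M f" and p: "even p" and s: "0 < s"
  shows "measure M {x \<in> space M. s < \<bar>f x\<bar>} \<le> (\<integral>x. f x ^ p \<partial>M) / s ^ p"
proof -
  let ?S = "{x \<in> space M. s < \<bar>f x\<bar>}"
  have S: "?S \<in> sets M" by (rule bdd_meas_tail[OF f])
  have "s ^ p * measure M ?S = (\<integral>x. s ^ p * indicator ?S x \<partial>M)"
    using S by simp
  also have "\<dots> \<le> (\<integral>x. f x ^ p \<partial>M)"
  proof (intro integral_mono bdd_meas_integrable bdd_meas_intros f S)
    fix x
    have "s ^ p \<le> f x ^ p" if "s < \<bar>f x\<bar>"
      using power_mono[of s "\<bar>f x\<bar>" p] that s p by (simp add: power_even_abs)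
    then show "s ^ p * indicator ?S x \<le> f x ^ p"
      using p by (auto simp: indicator_def zero_le_even_power)
  qed
  finally show ?thesis using s by (simp add: field_simps)
qed

text \<open>Off the tail event \<open>f x ^ p\<close> contributes at most half of the mean; on it,
  Cauchy-Schwarz in the form \<open>f x ^ p \<le> (l * f x ^ (2*p) + 1 / l) / 2\<close> turns the
  doubling hypothesis into a lower bound for the measure of the event.\<close>

lemma paley_zygmund_even_power:
  assumes f: "bdd_meas M f" and M1: "measure M (space M) \<le> 1" and p: "even p" and z: "0 < z"
    and A: "0 < A" and dbl: "(\<integral>x. f x ^ (2*p) \<partial>M) \<le> A * (\<integral>x. f x ^ p \<partial>M)\<^sup>2"
    and le: "2 * z ^ p \<le> (\<integral>x. f x ^ p \<partial>M)"
  shows "1 \<le> 4 * A * measure M {x \<in> space M. z < \<bar>f x\<bar>}"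
proof -
  let ?S = "{x \<in> space M. z < \<bar>f x\<bar>}"
  define \<mu> where "\<mu> = measure M ?S"
  define m where "m = (\<integral>x. f x ^ p \<partial>M)"
  \<comment> \<open>Chosen so that \<open>l * (A * m\<^sup>2)\<close> is \<open>m / 2\<close>. After
    halving, the doubling term takes \<open>m / 4\<close>, and another \<open>m / 4\<close> is left
    for the tail to supply.\<close>
  define l where "l = 1 / (2 * A * m)"
  have S: "?S \<in> sets M" by (rule bdd_meas_tail[OF f])
  have m: "0 < m" using le z unfolding m_def by (intro less_le_trans[OF _ le]) simp
  have l: "0 < l" using A m by (simp add: l_def)
  have "m \<le> (\<integral>x. z ^ p + (l * f x ^ (2*p) + 1 / l * indicator ?S x) / 2 \<partial>M)"
    unfolding m_def
  proof (intro integral_mono bdd_meas_integrable)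
    show "bdd_meas M (\<lambda>x. f x ^ p)" by (intro bdd_meas_intros f)
    have "bdd_meas M (\<lambda>x. z ^ p + 1/2 * (l * f x ^ (2*p) + 1 / l * indicator ?S x))"
      by (intro bdd_meas_intros f S)
    then show "bdd_meas M (\<lambda>x. z ^ p + (l * f x ^ (2*p) + 1 / l * indicator ?S x) / 2)" by simp
    have half_sum: "0 \<le> a + b - 2 * c \<Longrightarrow> 0 \<le> d \<Longrightarrow> c \<le> d + (a + b) / 2" for a b c d :: real
      by (simp add: field_simps)
    fix x assume x: "x \<in> space M"
    show "f x ^ p \<le> z ^ p + (l * f x ^ (2*p) + 1 / l * indicator ?S x) / 2"
    proof (cases "z < \<bar>f x\<bar>")
      case True
      have "0 \<le> (l * f x ^ p - 1)\<^sup>2 / l" using l by simp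
      also have "\<dots> = l * f x ^ (2*p) + 1 / l - 2 * f x ^ p"
      proof -
        have "(l * y - 1)\<^sup>2 / l = l * y\<^sup>2 + 1 / l - 2 * y" for y
          using l by (simp add: power2_eq_square field_simps)
        moreover have "f x ^ (2*p) = (f x ^ p)\<^sup>2" by (simp add: power_mult[symmetric] mult.commute)
        ultimately show ?thesis by (simp only:)
      qed
      finally have "0 \<le> l * f x ^ (2*p) + 1 / l - 2 * f x ^ p" .
      moreover have "0 \<le> z ^ p" using z by simp
      moreover have "indicator ?S x = (1::real)" using True x by simp
      ultimately show ?thesis 
        using half_sum[of "l * f x ^ (2*p)" "1 / l" "f x ^ p" "z ^ p"] by (simp only: mult_1_right)
    next
      case False
      then have "\<bar>f x\<bar> ^ p \<le> z ^ p" by (intro power_mono) auto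
      then have "f x ^ p \<le> z ^ p" using p by (simp add: power_even_abs)
      moreover have "0 \<le> l * f x ^ (2*p)" using l by simp
      ultimately show ?thesis using False by simp
    qed
  qed
  also have "\<dots> = z ^ p * measure M (space M) + (l * (\<integral>x. f x ^ (2*p) \<partial>M) + 1 / l * \<mu>) / 2"
  proof -
    have "integrable M (\<lambda>x. f x ^ (2*p))" "integrable M (indicator ?S :: _ \<Rightarrow> real)"
      by (intro bdd_meas_integrable bdd_meas_intros f S)+
    then show ?thesis using S by (simp add: \<mu>_def)
  qed
  also have "\<dots> \<le> m / 2 + (l * (A * m\<^sup>2) + 1 / l * \<mu>) / 2"
  proof -
    have "z ^ p * measure M (space M) \<le> z ^ p * 1" using z M1 by (intro mult_left_mono) auto
    then have "z ^ p * measure M (space M) \<le> m / 2" using le unfolding m_def by simp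
    moreover have "l * (\<integral>x. f x ^ (2*p) \<partial>M) \<le> l * (A * m\<^sup>2)"
      using dbl l unfolding m_def by (intro mult_left_mono) auto
    ultimately show ?thesis by (intro add_mono divide_right_mono) auto
  qed
  also have "\<dots> = m / 2 + (m / 2 + 2 * A * m * \<mu>) / 2"
    using m A by (simp add: l_def power2_eq_square)
  finally have "m * 1 \<le> m * (4 * A * \<mu>)" by (simp add: field_simps)
  then show ?thesis using m unfolding \<mu>_def by (simp only: mult_le_cancel_left_pos)
qed

end

text \<open>For the case in which no exponent reaches its level: Markov's inequality along the
  powers of two then forces the tail to vanish.\<close>

lemma le_zero_of_le_powers:
  fixes x :: real
  assumes "\<And>k::nat. x \<le> 2 * (1/8) ^ (2 ^ Suc k)"
  shows "x \<le> 0"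
proof (rule LIMSEQ_le_const)
  show "(\<lambda>k. 2 * (1/8::real) ^ k) \<longlonglongrightarrow> 0"
    by (intro tendsto_mult_right_zero LIMSEQ_realpow_zero) auto
  have "x \<le> 2 * (1/8) ^ k" for k
  proof -
    have "x \<le> 2 * (1/8) ^ (2 ^ Suc k)" by (rule assms)
    also have "\<dots> \<le> 2 * (1/8) ^ k"
      using less_exp[of "Suc k"] by (intro mult_left_mono power_decreasing) auto
    finally show ?thesis .
  qed
  then show "\<exists>N. \<forall>n\<ge>N. x \<le> 2 * (1/8) ^ n" by blast
qed

text \<open>Let \<open>p\<close> run through the powers of two. At the first \<open>p\<close> for which \<open>z\<close> falls below the level
  of the \<open>p\<close>-th moment of \<open>X\<close>, Paley-Zygmund bounds the tail of \<open>X\<close> at \<open>z\<close> from below, while Markov's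
  inequality for the preceding exponent bounds the tail of \<open>Y\<close>, both exponentially in \<open>p\<close>.\<close>
lemma tail_le_of_moments_le:
  fixes X :: "'a \<Rightarrow> real" and Y :: "'b \<Rightarrow> real"
  assumes M: "finite_measure M" "measure M (space M) \<le> 1" and N: "finite_measure N" "measure N (space N) \<le> 1"
    and X: "bdd_meas M X" and Y: "bdd_meas N Y" and A: "1 \<le> A" and z: "0 < z"
    and mom: "\<And>p. even p \<Longrightarrow> 0 < p \<Longrightarrow> (\<integral>y. Y y ^ p \<partial>N) \<le> A ^ p * (\<integral>x. X x ^ p \<partial>M)"
    and dbl: "\<And>p. even p \<Longrightarrow> 0 < p \<Longrightarrow> (\<integral>x. X x ^ (2*p) \<partial>M) \<le> A ^ p * (\<integral>x. X x ^ p \<partial>M)\<^sup>2"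
  shows "measure N {y \<in> space N. 8 * A ^ 3 * z < \<bar>Y y\<bar>} \<le> 8 * A ^ 3 * measure M {x \<in> space M. z < \<bar>X x\<bar>}"
proof -
  interpret M: finite_measure M by fact
  interpret N: finite_measure N by fact
  define m where "m p = (\<integral>x. X x ^ p \<partial>M)" for p
  define \<mu> where "\<mu> = measure M {x \<in> space M. z < \<bar>X x\<bar>}"
  define \<nu> where "\<nu> = measure N {y \<in> space N. 8 * A ^ 3 * z < \<bar>Y y\<bar>}"
  define e where "e k = (2::nat) ^ Suc k" for k
  have e: "even (e k)" "0 < e k" "e (Suc k) = 2 * e k" for k by (simp_all add: e_def)
  have A3: "1 \<le> A ^ 3" using A by simp
  have pz: "1 \<le> 4 * A ^ p * \<mu>" if "even p" "0 < p" "2 * z ^ p \<le> m p" for p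
    unfolding \<mu>_def using that A
    by (intro M.paley_zygmund_even_power[OF X M(2) _ z _ dbl]) (auto simp: m_def)
  \<comment> \<open>In the level \<open>8 * A ^ 3 * z\<close>, one factor \<open>A\<close> cancels
    the constant of the moment comparison, \<open>A\<^sup>2\<close> compensates the
    \<open>A ^ (2*p)\<close> that Paley-Zygmund loses at the next exponent \<open>2*p\<close>, and
    the 8 gives decay when no exponent reaches its level.\<close>
  have markov: "\<nu> \<le> 2 / (8 * A\<^sup>2) ^ p" if p: "even p" "0 < p" and lt: "m p < 2 * z ^ p" for p
  proof -
    have "\<nu> \<le> (\<integral>y. Y y ^ p \<partial>N) / (8 * A ^ 3 * z) ^ p"
      unfolding \<nu>_def using p A z by (intro N.markov_even_power Y mult_pos_pos) auto
    also have "\<dots> \<le> A ^ p * (2 * z ^ p) / (8 * A ^ 3 * z) ^ p"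
    proof (intro divide_right_mono)
      have "(\<integral>y. Y y ^ p \<partial>N) \<le> A ^ p * m p" unfolding m_def by (rule mom[OF p])
      also have "\<dots> \<le> A ^ p * (2 * z ^ p)" using lt A by (intro mult_left_mono) auto
      finally show "(\<integral>y. Y y ^ p \<partial>N) \<le> A ^ p * (2 * z ^ p)" .
      show "0 \<le> (8 * A ^ 3 * z) ^ p" using A z by simp
    qed
    also have "(8 * A ^ 3 * z) ^ p = (A ^ p * z ^ p) * (8 * A\<^sup>2) ^ p"
      by (simp add: power_mult_distrib[symmetric] power2_eq_square power3_eq_cube ac_simps)
    also have "A ^ p * (2 * z ^ p) / ((A ^ p * z ^ p) * (8 * A\<^sup>2) ^ p) = 2 / (8 * A\<^sup>2) ^ p"
      using A z by simp
    finally show ?thesis .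
  qed
  consider (none) "\<And>k. m (e k) < 2 * z ^ e k" | (first) "2 * z ^ e 0 \<le> m (e 0)"
    | (step) k where "m (e k) < 2 * z ^ e k" "2 * z ^ e (Suc k) \<le> m (e (Suc k))"
  proof (cases "\<exists>k. 2 * z ^ e k \<le> m (e k)")
    case True
    define k where "k = (LEAST k. 2 * z ^ e k \<le> m (e k))"
    have k: "2 * z ^ e k \<le> m (e k)" using True unfolding k_def by (rule LeastI_ex)
    show ?thesis
    proof (cases k)
      case 0
      then show ?thesis using k that(2) by simp
    next
      case (Suc j)
      then have "\<not> 2 * z ^ e j \<le> m (e j)" by (intro not_less_Least) (simp add: k_def)
      then show ?thesis using k Suc that(3)[of j] by simp
    qed
  next
    case False
    then show ?thesis using that(1) by (simp add: not_le)
  qed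
  then have "\<nu> \<le> 8 * A ^ 3 * \<mu>"
  proof cases
    case none
    have "\<nu> \<le> 2 * (1/8) ^ (2 ^ Suc k)" for k
    proof -
      have "\<nu> \<le> 2 / (8 * A\<^sup>2) ^ e k" by (intro markov none e)
      also have "\<dots> \<le> 2 / 8 ^ e k" using A by (intro divide_left_mono power_mono) auto
      also have "\<dots> = 2 * (1/8) ^ e k" by (simp add: power_divide)
      finally show ?thesis unfolding e_def .
    qed
    then have "\<nu> \<le> 0" by (rule le_zero_of_le_powers)
    moreover have "0 \<le> 8 * A ^ 3 * \<mu>" using A by (simp add: \<mu>_def)
    ultimately show ?thesis by linarith
  next
    case first
    have "\<nu> \<le> measure N (space N)"
      unfolding \<nu>_def by (rule N.bounded_measure)
    also have "\<dots> \<le> 1" by (rule N(2))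
    also have "1 \<le> 4 * A ^ e 0 * \<mu>" by (intro pz e first)
    also have "\<dots> \<le> 8 * A ^ 3 * \<mu>"
      using A by (intro mult_right_mono mult_mono power_increasing) (auto simp: e_def \<mu>_def)
    finally show ?thesis .
  next
    case step
    have "\<nu> \<le> 2 / (8 * A\<^sup>2) ^ e k" by (intro markov e step)
    also have "\<dots> \<le> 2 / (1 * (A\<^sup>2) ^ e k)"
      using A unfolding power_mult_distrib by (intro divide_left_mono mult_right_mono) auto
    also have "\<dots> \<le> 2 / (A\<^sup>2) ^ e k * (4 * A ^ e (Suc k) * \<mu>)"
      using mult_left_mono[OF pz[OF e(1,2) step(2)], of "2 / (A\<^sup>2) ^ e k"] A by simp
    also have "\<dots> = 8 * 1 * \<mu>" using A by (simp add: e(3) power_mult)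
    also have "\<dots> \<le> 8 * A ^ 3 * \<mu>"
      using A3 by (intro mult_right_mono mult_left_mono) (auto simp: \<mu>_def)
    finally show ?thesis .
  qed
  then show ?thesis by (simp add: \<mu>_def \<nu>_def)
qed

section \<open>Moment comparison through Riesz products\<close>

context finite_measure
begin

text \<open>Integrate \<open>sum_power_le_rad_mean\<close>: only the masses of the Riesz products
  enter, and the bound 2 instead of 1 leaves room for their errors.\<close>

lemma moment_le_rad_mean:
  assumes g: "\<And>i. i < m \<Longrightarrow> bdd_meas M (g i)" "\<And>i x. i < m \<Longrightarrow> x \<in> space M \<Longrightarrow> \<bar>g i x\<bar> \<le> 1"
    and U: "\<And>\<epsilon>. \<epsilon> \<in> signs \<Longrightarrow> (\<integral>x. riesz m (\<lambda>i. g i x) \<epsilon> \<partial>M) \<le> 2"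
    and p: "even p"
  shows "(\<integral>x. (\<Sum>i<m. a i * g i x) ^ p \<partial>M) \<le> 2 * rad_mean m (\<lambda>\<epsilon>. rad_sum m a \<epsilon> ^ p)"
proof -
  have int: "integrable M (\<lambda>x. rad_sum m a \<epsilon> ^ p * riesz m (\<lambda>i. g i x) \<epsilon>)" for \<epsilon>
    by (intro bdd_meas_integrable bdd_meas_intros bdd_meas_riesz g)
  have "(\<integral>x. (\<Sum>i<m. a i * g i x) ^ p \<partial>M)
      \<le> (\<integral>x. rad_mean m (\<lambda>\<epsilon>. rad_sum m a \<epsilon> ^ p * riesz m (\<lambda>i. g i x) \<epsilon>) \<partial>M)"
    by (intro integral_mono bdd_meas_integrable integrable_rad_mean int sum_power_le_rad_mean
        bdd_meas_intros g p) auto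
  also have "\<dots> = rad_mean m (\<lambda>\<epsilon>. rad_sum m a \<epsilon> ^ p * (\<integral>x. riesz m (\<lambda>i. g i x) \<epsilon> \<partial>M))"
    by (subst integral_rad_mean[OF int]) simp
  also have "\<dots> \<le> rad_mean m (\<lambda>\<epsilon>. 2 * rad_sum m a \<epsilon> ^ p)"
    using U p by (intro rad_mean_mono) (simp add: mult.commute[of 2] mult_left_mono zero_le_even_power)
  finally show ?thesis by (simp only: rad_mean_cmult)
qed

end

text \<open>Young's inequality with crude constants, by comparing \<open>u\<close> with
  \<open>\<kappa> * v\<close>. A small \<open>\<kappa>\<close> makes the power of \<open>v\<close>
  absorbable.\<close>

lemma mult_power_le:
  fixes u v \<kappa> :: real
  assumes "0 \<le> u" "0 \<le> v" "0 < \<kappa>"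
  shows "u * v ^ r \<le> \<kappa> * v ^ Suc r + u ^ Suc r / \<kappa> ^ r"
proof (cases "u \<le> \<kappa> * v")
  case True
  then have "u * v ^ r \<le> (\<kappa> * v) * v ^ r" using assms by (intro mult_right_mono) auto
  moreover have "0 \<le> u ^ Suc r / \<kappa> ^ r" using assms by simp
  ultimately show ?thesis by (simp add: mult.assoc)
next
  case False
  then have "v \<le> u / \<kappa>" using assms by (simp add: field_simps)
  then have "u * v ^ r \<le> u * (u / \<kappa>) ^ r" using assms by (intro mult_left_mono power_mono) auto
  moreover have "0 \<le> \<kappa> * v ^ Suc r" using assms by simp
  ultimately show ?thesis by (simp add: power_divide)
qed

context finite_measure
begin

text \<open>Test \<open>X = \<Sum> a\<^sub>i g\<^sub>i\<close> against \<open>rad_mean (R\<^sup>r P)\<close>, where \<open>R\<close> is the Rademacher sum and \<open>P\<close>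
  the Riesz product.\<close>
lemma rad_mean_le_moment:
  assumes g: "\<And>i. i < m \<Longrightarrow> bdd_meas M (g i)" "\<And>i x. i < m \<Longrightarrow> x \<in> space M \<Longrightarrow> \<bar>g i x\<bar> \<le> 1"
    and U: "\<And>\<epsilon>. \<epsilon> \<in> signs \<Longrightarrow> (\<integral>x. riesz m (\<lambda>i. g i x) \<epsilon> \<partial>M) \<le> 2"
    and J: "J \<in> sets M" and c: "0 < c"
    and L: "\<And>\<epsilon> i. \<epsilon> \<in> signs \<Longrightarrow> i < m \<Longrightarrow>
      \<bar>(\<integral>x. indicator J x * (g i x * riesz m (\<lambda>i. g i x) \<epsilon>) \<partial>M) - \<epsilon> i * l \<epsilon>\<bar> \<le> e i"
    and l: "\<And>\<epsilon>. \<epsilon> \<in> signs \<Longrightarrow> c / 2 \<le> l \<epsilon>" and e: "(\<Sum>i<m. e i) \<le> c / 8" "\<And>i. 0 \<le> e i"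
    and p: "even p" "0 < p"
  shows "(c / 16) ^ p * rad_mean m (\<lambda>\<epsilon>. rad_sum m a \<epsilon> ^ p)
    \<le> (\<integral>x. indicator J x * (\<Sum>i<m. a i * g i x) ^ p \<partial>M)"
proof -
  obtain r where r: "p = Suc r" using p by (cases p) auto
  define R where "R = rad_sum m a"
  define P where "P \<epsilon> x = riesz m (\<lambda>i. g i x) \<epsilon>" for \<epsilon> x
  define X where "X x = (\<Sum>i<m. a i * g i x)" for x
  define I where "I i \<epsilon> = (\<integral>x. indicator J x * (g i x * P \<epsilon> x) \<partial>M)" for i \<epsilon>
  define \<rho> where "\<rho> = rad_mean m (\<lambda>\<epsilon>. R \<epsilon> ^ p)"
  \<comment> \<open>Young's inequality will cost \<open>2 * \<kappa> * \<rho>\<close>, because each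
    Riesz product has mass at most 2; with this value that is half of the
    \<open>c / 4 * \<rho>\<close> left after the errors.\<close>
  define \<kappa> where "\<kappa> = c / 16"
  define T where "T = (\<integral>x. indicator J x * X x ^ p \<partial>M)"
  have \<kappa>: "0 < \<kappa>" using c by (simp add: \<kappa>_def)
  have P: "bdd_meas M (P \<epsilon>)" for \<epsilon> unfolding P_def by (intro bdd_meas_riesz g)
  have X: "bdd_meas M X" unfolding X_def by (intro bdd_meas_intros g) auto
  have P0: "0 \<le> P \<epsilon> x" if "\<epsilon> \<in> signs" "x \<in> space M" for \<epsilon> x
    unfolding P_def using that g by (intro riesz_nonneg)
  have Rp: "0 \<le> R \<epsilon> ^ p" for \<epsilon> using p by (simp add: zero_le_even_power)
  have young: "\<bar>u\<bar> * \<bar>R \<epsilon>\<bar> ^ r \<le> t * R \<epsilon> ^ p + u ^ p / t ^ r" if "0 < t" for u t \<epsilon>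
    using mult_power_le[of "\<bar>u\<bar>" "\<bar>R \<epsilon>\<bar>" t r] that p by (simp only: r[symmetric] power_even_abs)
  \<comment> \<open>The error budget: \<open>a i ^ p\<close> is at most \<open>\<rho>\<close> by
    \<open>coeff_power_le_rad_mean\<close>, so all coefficient errors together cost at most
    \<open>c / 8 * (2 * \<rho>)\<close>, half of the main term.\<close>
  have "c / 4 * \<rho> \<le> c / 2 * \<rho> + (\<Sum>i<m. - e i * (\<rho> + a i ^ p))"
  proof -
    have "(\<Sum>i<m. e i * (\<rho> + a i ^ p)) \<le> (\<Sum>i<m. e i * (\<rho> + \<rho>))"
      unfolding \<rho>_def R_def using e p
      by (intro sum_mono mult_left_mono add_mono coeff_power_le_rad_mean) auto
    also have "\<dots> = (\<Sum>i<m. e i) * (2 * \<rho>)" by (simp add: sum_distrib_right)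
    also have "\<dots> \<le> c / 8 * (2 * \<rho>)"
      using e Rp by (intro mult_right_mono) (auto simp: \<rho>_def intro: rad_mean_nonneg)
    finally show ?thesis by (simp add: sum_negf)
  qed
  also have "\<dots> = rad_mean m (\<lambda>\<epsilon>. c / 2 * R \<epsilon> ^ p + (\<Sum>i<m. - e i * (R \<epsilon> ^ p + a i ^ p)))"
    unfolding rad_mean_add rad_mean_sum rad_mean_cmult rad_mean_const \<rho>_def ..
  also have "\<dots> \<le> rad_mean m (\<lambda>\<epsilon>. \<Sum>i<m. (R \<epsilon> ^ r * a i) * I i \<epsilon>)"
  proof (intro rad_mean_mono)
    fix \<epsilon> assume \<epsilon>: "\<epsilon> \<in> signs"
    \<comment> \<open>Replacing \<open>I i \<epsilon>\<close> by
      \<open>\<epsilon> i * l \<epsilon>\<close> costs at most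
      \<open>\<bar>a i\<bar> * \<bar>R \<epsilon>\<bar> ^ r * e i\<close>; Young's inequality with
      weight 1 splits this into the p-th powers subtracted on the left.\<close>
    have *: "R \<epsilon> ^ r * a i * (\<epsilon> i * l \<epsilon>) - e i * (R \<epsilon> ^ p + a i ^ p) \<le> R \<epsilon> ^ r * a i * I i \<epsilon>"
      if "i < m" for i
    proof -
      have "- (R \<epsilon> ^ r * a i * (I i \<epsilon> - \<epsilon> i * l \<epsilon>)) \<le> \<bar>R \<epsilon> ^ r * a i * (I i \<epsilon> - \<epsilon> i * l \<epsilon>)\<bar>"
        by (rule abs_ge_minus_self)
      also have "\<dots> = (\<bar>a i\<bar> * \<bar>R \<epsilon>\<bar> ^ r) * \<bar>I i \<epsilon> - \<epsilon> i * l \<epsilon>\<bar>"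
        by (simp add: abs_mult power_abs)
      also have "\<dots> \<le> (1 * R \<epsilon> ^ p + a i ^ p / 1 ^ r) * e i"
        unfolding I_def P_def using Rp p
        by (intro mult_mono young L \<epsilon> that) (auto simp: zero_le_even_power)
      finally show ?thesis by (simp add: algebra_simps)
    qed
    have "c / 2 * R \<epsilon> ^ p \<le> l \<epsilon> * R \<epsilon> ^ p" by (intro mult_right_mono l \<epsilon> Rp)
    also have "\<dots> = (\<Sum>i<m. R \<epsilon> ^ r * a i * (\<epsilon> i * l \<epsilon>))"
      by (simp add: r R_def rad_sum_def sum_distrib_left sum_distrib_right ac_simps)
    finally have "c / 2 * R \<epsilon> ^ p + (\<Sum>i<m. - e i * (R \<epsilon> ^ p + a i ^ p))
      \<le> (\<Sum>i<m. R \<epsilon> ^ r * a i * (\<epsilon> i * l \<epsilon>) - e i * (R \<epsilon> ^ p + a i ^ p))"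
      by (simp add: sum_subtractf sum_negf)
    also have "\<dots> \<le> (\<Sum>i<m. R \<epsilon> ^ r * a i * I i \<epsilon>)" by (intro sum_mono *) auto
    finally show "c / 2 * R \<epsilon> ^ p + (\<Sum>i<m. - e i * (R \<epsilon> ^ p + a i ^ p)) \<le> \<dots>" .
  qed
  also have "\<dots> = rad_mean m (\<lambda>\<epsilon>. \<integral>x. indicator J x * X x * (R \<epsilon> ^ r * P \<epsilon> x) \<partial>M)"
  proof (intro rad_mean_cong)
    fix \<epsilon>
    have "(\<Sum>i<m. (R \<epsilon> ^ r * a i) * I i \<epsilon>) = (\<Sum>i<m. \<integral>x. (R \<epsilon> ^ r * a i) * (indicator J x * (g i x * P \<epsilon> x)) \<partial>M)"
      unfolding I_def by simp
    also have "\<dots> = (\<integral>x. (\<Sum>i<m. (R \<epsilon> ^ r * a i) * (indicator J x * (g i x * P \<epsilon> x))) \<partial>M)"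
      using g P J by (intro Bochner_Integration.integral_sum[symmetric] bdd_meas_integrable bdd_meas_intros) auto
    also have "\<dots> = (\<integral>x. indicator J x * X x * (R \<epsilon> ^ r * P \<epsilon> x) \<partial>M)"
      by (intro Bochner_Integration.integral_cong refl)
        (simp add: X_def sum_distrib_left sum_distrib_right ac_simps)
    finally show "(\<Sum>i<m. (R \<epsilon> ^ r * a i) * I i \<epsilon>) = \<dots>" .
  qed
  also have "\<dots> \<le> rad_mean m (\<lambda>\<epsilon>. \<integral>x. (\<kappa> * R \<epsilon> ^ p) * P \<epsilon> x + 1 / \<kappa> ^ r * (indicator J x * X x ^ p * P \<epsilon> x) \<partial>M)"
  proof (intro rad_mean_mono integral_mono bdd_meas_integrable bdd_meas_intros P X J)
    fix \<epsilon> x assume \<epsilon>: "\<epsilon> \<in> signs" and x: "x \<in> space M"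
    have "X x * R \<epsilon> ^ r \<le> \<bar>X x\<bar> * \<bar>R \<epsilon>\<bar> ^ r"
      by (metis abs_ge_self abs_mult power_abs)
    also have "\<dots> \<le> \<kappa> * R \<epsilon> ^ p + X x ^ p / \<kappa> ^ r" by (rule young[OF \<kappa>])
    finally have "X x * R \<epsilon> ^ r * P \<epsilon> x \<le> (\<kappa> * R \<epsilon> ^ p + X x ^ p / \<kappa> ^ r) * P \<epsilon> x"
      using P0[OF \<epsilon> x] by (rule mult_right_mono)
    moreover have "0 \<le> \<kappa> * R \<epsilon> ^ p * P \<epsilon> x" using P0[OF \<epsilon> x] Rp[of \<epsilon>] \<kappa> by simp
    ultimately show "indicator J x * X x * (R \<epsilon> ^ r * P \<epsilon> x)
        \<le> (\<kappa> * R \<epsilon> ^ p) * P \<epsilon> x + 1 / \<kappa> ^ r * (indicator J x * X x ^ p * P \<epsilon> x)"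
      by (cases "x \<in> J") (simp_all add: algebra_simps)
  qed
  also have "\<dots> = rad_mean m (\<lambda>\<epsilon>. (\<kappa> * R \<epsilon> ^ p) * (\<integral>x. P \<epsilon> x \<partial>M)
      + 1 / \<kappa> ^ r * (\<integral>x. indicator J x * X x ^ p * P \<epsilon> x \<partial>M))"
  proof (intro rad_mean_cong)
    fix \<epsilon>
    have "integrable M (P \<epsilon>)" "integrable M (\<lambda>x. indicator J x * X x ^ p * P \<epsilon> x)"
      by (intro bdd_meas_integrable bdd_meas_intros P X J)+
    then show "(\<integral>x. (\<kappa> * R \<epsilon> ^ p) * P \<epsilon> x + 1 / \<kappa> ^ r * (indicator J x * X x ^ p * P \<epsilon> x) \<partial>M)
      = (\<kappa> * R \<epsilon> ^ p) * (\<integral>x. P \<epsilon> x \<partial>M) + 1 / \<kappa> ^ r * (\<integral>x. indicator J x * X x ^ p * P \<epsilon> x \<partial>M)"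
      by simp
  qed
  \<comment> \<open>\<open>X\<close> does not depend on the signs, so averaging before integrating
    replaces the Riesz product by its mean 1 and leaves \<open>T\<close>.\<close>
  also have "\<dots> = rad_mean m (\<lambda>\<epsilon>. (\<kappa> * R \<epsilon> ^ p) * (\<integral>x. P \<epsilon> x \<partial>M)) + 1 / \<kappa> ^ r * T"
  proof -
    have "rad_mean m (\<lambda>\<epsilon>. \<integral>x. indicator J x * X x ^ p * P \<epsilon> x \<partial>M)
        = (\<integral>x. rad_mean m (\<lambda>\<epsilon>. indicator J x * X x ^ p * P \<epsilon> x) \<partial>M)"
      by (intro integral_rad_mean[symmetric] bdd_meas_integrable bdd_meas_intros P X J)
    also have "\<dots> = T"
      unfolding T_def P_def rad_mean_cmult rad_mean_riesz by simp
    finally show ?thesis by (simp only: rad_mean_add rad_mean_cmult)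
  qed
  also have "\<dots> \<le> 2 * \<kappa> * \<rho> + 1 / \<kappa> ^ r * T"
  proof -
    have "rad_mean m (\<lambda>\<epsilon>. (\<kappa> * R \<epsilon> ^ p) * (\<integral>x. P \<epsilon> x \<partial>M)) \<le> rad_mean m (\<lambda>\<epsilon>. (2 * \<kappa>) * R \<epsilon> ^ p)"
    proof (intro rad_mean_mono)
      fix \<epsilon> assume "\<epsilon> \<in> signs"
      then have "(\<kappa> * R \<epsilon> ^ p) * (\<integral>x. P \<epsilon> x \<partial>M) \<le> (\<kappa> * R \<epsilon> ^ p) * 2"
        unfolding P_def using Rp \<kappa> by (intro mult_left_mono U) auto
      then show "(\<kappa> * R \<epsilon> ^ p) * (\<integral>x. P \<epsilon> x \<partial>M) \<le> (2 * \<kappa>) * R \<epsilon> ^ p" by simp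
    qed
    then show ?thesis unfolding rad_mean_cmult \<rho>_def by simp
  qed
  finally have "c / 4 * \<rho> \<le> 2 * \<kappa> * \<rho> + 1 / \<kappa> ^ r * T" .
  moreover have "c / 4 * \<rho> = 4 * \<kappa> * \<rho>" by (simp add: \<kappa>_def)
  ultimately have "2 * \<kappa> * \<rho> \<le> 1 / \<kappa> ^ r * T" by linarith
  then have "2 * (\<kappa> ^ p * \<rho>) \<le> T" using \<kappa> by (simp add: r field_simps)
  moreover have "0 \<le> \<kappa> ^ p * \<rho>"
    using \<kappa> Rp by (simp add: \<rho>_def rad_mean_nonneg)
  ultimately show ?thesis
    unfolding T_def \<kappa>_def \<rho>_def R_def X_def by linarith
qed

end

section \<open>Selection of subsequences\<close>

text \<open>The condition at each stage may depend on the whole list of earlier choices; as it holds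
  eventually, an index beyond all of them satisfies it.\<close>

lemma exists_strict_mono_selection:
  assumes ev: "\<And>xs :: nat list. eventually (Q xs) sequentially"
  shows "\<exists>s. strict_mono s \<and> (\<forall>n. Q (map s [0..<n]) (s n))"
proof -
  define pick where "pick xs = (SOME k. Q xs k \<and> (\<forall>x\<in>set xs. x < k))" for xs
  have nx: "Q xs (pick xs) \<and> (\<forall>x\<in>set xs. x < pick xs)" for xs
  proof -
    have "eventually (\<lambda>k. Q xs k \<and> (\<forall>x\<in>set xs. x < k)) sequentially"
      by (intro eventually_conj ev eventually_ball_finite ballI eventually_gt_at_top) simp
    then have "\<exists>k. Q xs k \<and> (\<forall>x\<in>set xs. x < k)" by (auto simp: eventually_sequentially)
    then show ?thesis unfolding pick_def by (rule someI_ex)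
  qed
  define p where "p = rec_nat [] (\<lambda>_ xs. xs @ [pick xs])"
  define s where "s n = pick (p n)" for n
  have p: "p 0 = []" "p (Suc n) = p n @ [s n]" for n by (simp_all add: p_def s_def)
  have ps: "p n = map s [0..<n]" for n by (induction n) (simp_all add: p)
  have "s n < s (Suc n)" for n
    using nx[of "p (Suc n)"] by (simp add: s_def[of "Suc n"] p)
  then have "strict_mono s" by (simp add: strict_mono_Suc_iff)
  moreover have "Q (map s [0..<n]) (s n)" for n
    using nx[of "p n"] by (simp add: s_def[symmetric] ps[symmetric])
  ultimately show ?thesis by blast
qed

lemma diagonal_convergent_subsequence:
  fixes F :: "nat \<Rightarrow> 'i::countable \<Rightarrow> real"
  assumes "\<And>n i. \<bar>F n i\<bar> \<le> B i"
  shows "\<exists>r. strict_mono r \<and> (\<forall>i. convergent (\<lambda>n. F (r n) i))"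
proof -
  \<comment> \<open>Rescaling gives all coordinates the common bound 1; the added 1 keeps the
    divisor positive.\<close>
  define c where "c i = 1 + \<bar>B i\<bar>" for i
  have c: "0 < c i" for i by (simp add: c_def)
  have le: "norm (F n i / c i) \<le> 1" for n i
  proof -
    have "\<bar>F n i\<bar> \<le> c i" using assms[of n i] by (simp add: c_def)
    then show ?thesis using c[of i] by simp
  qed
  obtain r :: "nat \<Rightarrow> nat" where r: "strict_mono r"
    and lim: "\<And>i. i \<in> UNIV \<Longrightarrow> \<exists>l. (\<lambda>n. F (r n) i / c i) \<longlonglongrightarrow> l"
    by (rule function_convergent_subsequence[of "UNIV :: 'i set" "\<lambda>n i. F n i / c i" 1])
      (use le in \<open>auto simp del: real_norm_def\<close>)
  have "convergent (\<lambda>n. F (r n) i)" for i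
  proof -
    obtain l where "(\<lambda>n. F (r n) i / c i) \<longlonglongrightarrow> l" using lim by auto
    then have "(\<lambda>n. c i * (F (r n) i / c i)) \<longlonglongrightarrow> c i * l" by (intro tendsto_intros)
    then show ?thesis using c[of i] by (auto simp: convergent_def)
  qed
  then show ?thesis using r by blast
qed

section \<open>Weak nullity against a limit functional\<close>

context finite_measure
begin

lemma abs_integral_le:
  assumes "bdd_meas M f" "bdd_meas M g" "\<And>x. x \<in> space M \<Longrightarrow> \<bar>f x\<bar> \<le> g x"
  shows "\<bar>\<integral>x. f x \<partial>M\<bar> \<le> (\<integral>x. g x \<partial>M)"
proof -
  have "\<bar>\<integral>x. f x \<partial>M\<bar> \<le> (\<integral>x. \<bar>f x\<bar> \<partial>M)" by (rule integral_abs_bound)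
  also have "\<dots> \<le> (\<integral>x. g x \<partial>M)"
    using assms by (intro integral_mono bdd_meas_integrable bdd_meas_intros)
  finally show ?thesis .
qed

text \<open>A Bessel-type argument: if \<open>b\<close> stayed away from zero, a signed sum of \<open>N\<close> almost orthogonal
  functions \<open>w * v k\<close> would have \<open>L\<^sup>2\<close>-norm of order \<open>\<surd>N\<close>, while the limit functional, which is
  bounded by the \<open>L\<^sup>2\<close>-norm, would be of order \<open>N\<close> on it.\<close>
lemma limit_functional_weakly_null:
  assumes M1: "measure M (space M) \<le> 1"
    and v: "\<And>k. bdd_meas M (v k)" "\<And>k x. x \<in> space M \<Longrightarrow> \<bar>v k x\<bar> \<le> 1"
    and h: "\<And>n. bdd_meas M (h n)" "\<And>n x. x \<in> space M \<Longrightarrow> \<bar>h n x\<bar> \<le> 1"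
    and weak: "\<And>g. bdd_meas M g \<Longrightarrow> (\<lambda>k. \<integral>x. v k x * g x \<partial>M) \<longlonglongrightarrow> 0"
    and w: "bdd_meas M w"
    and b: "\<And>k. (\<lambda>n. \<integral>x. h n x * (w x * v k x) \<partial>M) \<longlonglongrightarrow> b k"
  shows "b \<longlonglongrightarrow> 0"
proof (rule ccontr)
  assume "\<not> b \<longlonglongrightarrow> 0"
  then obtain \<delta> where \<delta>: "0 < \<delta>" and inf: "\<And>m. \<exists>k\<ge>m. \<delta> \<le> \<bar>b k\<bar>"
    unfolding LIMSEQ_iff by (auto simp: not_less)
  obtain B where B: "\<And>x. x \<in> space M \<Longrightarrow> \<bar>w x\<bar> \<le> B" using w by (auto simp: bdd_meas_def)
  \<comment> \<open>\<open>G\<close> is built greedily as a signed sum of \<open>N\<close> functions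
    \<open>w * v k\<close>. Each summand adds at most \<open>B\<^sup>2\<close> by its own square and
    at most 2 by the cross term, since \<open>k\<close> is taken so late that \<open>v k\<close> is
    almost orthogonal to \<open>w * G\<close>.\<close>
  have ex: "\<exists>G l. bdd_meas M G \<and> (\<integral>x. (G x)\<^sup>2 \<partial>M) \<le> real N * (B\<^sup>2 + 2) \<and>
      (\<lambda>n. \<integral>x. h n x * G x \<partial>M) \<longlonglongrightarrow> l \<and> real N * \<delta> \<le> l" for N
  proof (induction N)
    case 0
    show ?case by (intro exI[of _ "\<lambda>_. 0"] exI[of _ 0]) simp
  next
    case (Suc N)
    then obtain G l where G: "bdd_meas M G" "(\<integral>x. (G x)\<^sup>2 \<partial>M) \<le> real N * (B\<^sup>2 + 2)"
      and l: "(\<lambda>n. \<integral>x. h n x * G x \<partial>M) \<longlonglongrightarrow> l" "real N * \<delta> \<le> l" by blast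
    have "bdd_meas M (\<lambda>x. w x * G x)" by (intro bdd_meas_intros w G)
    from LIMSEQ_D[OF weak[OF this], of 1] obtain m where
      m: "\<And>k. k \<ge> m \<Longrightarrow> \<bar>\<integral>x. v k x * (w x * G x) \<partial>M\<bar> < 1" by auto
    obtain k where k: "k \<ge> m" "\<delta> \<le> \<bar>b k\<bar>" using inf by blast
    define \<sigma> where "\<sigma> = sgn (b k)"
    have \<sigma>: "\<sigma> * b k = \<bar>b k\<bar>" "\<sigma>\<^sup>2 = 1" "\<bar>\<sigma>\<bar> = 1"
      using k \<delta> by (auto simp: \<sigma>_def sgn_if)
    define G' where "G' x = G x + \<sigma> * (w x * v k x)" for x
    have G': "bdd_meas M G'" unfolding G'_def by (intro bdd_meas_intros w v G)
    have "(\<integral>x. (G' x)\<^sup>2 \<partial>M) = (\<integral>x. (G x)\<^sup>2 + 2 * \<sigma> * (v k x * (w x * G x)) + (w x * v k x)\<^sup>2 \<partial>M)"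
    proof (intro Bochner_Integration.integral_cong refl)
      fix x
      have "(G' x)\<^sup>2 = (G x)\<^sup>2 + 2 * \<sigma> * (v k x * (w x * G x)) + \<sigma>\<^sup>2 * (w x * v k x)\<^sup>2"
        unfolding G'_def by (simp add: power2_eq_square algebra_simps)
      then show "(G' x)\<^sup>2 = (G x)\<^sup>2 + 2 * \<sigma> * (v k x * (w x * G x)) + (w x * v k x)\<^sup>2" by (simp add: \<sigma>)
    qed
    also have "\<dots> = (\<integral>x. (G x)\<^sup>2 \<partial>M) + 2 * (\<sigma> * (\<integral>x. v k x * (w x * G x) \<partial>M)) + (\<integral>x. (w x * v k x)\<^sup>2 \<partial>M)"
    proof -
      have "integrable M (\<lambda>x. (G x)\<^sup>2)" "integrable M (\<lambda>x. v k x * (w x * G x))"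
        "integrable M (\<lambda>x. (w x * v k x)\<^sup>2)"
        by (intro bdd_meas_integrable bdd_meas_intros v w G)+
      then show ?thesis by simp
    qed
    also have "\<dots> \<le> real N * (B\<^sup>2 + 2) + 2 * 1 + B\<^sup>2"
    proof (intro add_mono mult_left_mono G)
      have "\<bar>\<sigma> * (\<integral>x. v k x * (w x * G x) \<partial>M)\<bar> \<le> 1"
        using m[OF k(1)] by (simp add: abs_mult \<sigma>)
      then show "\<sigma> * (\<integral>x. v k x * (w x * G x) \<partial>M) \<le> 1" by linarith
      have "(\<integral>x. (w x * v k x)\<^sup>2 \<partial>M) \<le> (\<integral>x. B\<^sup>2 \<partial>M)"
      proof (intro integral_mono bdd_meas_integrable bdd_meas_intros v w)
        fix x assume x: "x \<in> space M"
        have "\<bar>w x * v k x\<bar> \<le> B * 1" unfolding abs_mult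
          using B[OF x] v(2)[OF x] by (intro mult_mono) auto
        then have "\<bar>w x * v k x\<bar>\<^sup>2 \<le> B\<^sup>2" by (intro power_mono) auto
        then show "(w x * v k x)\<^sup>2 \<le> B\<^sup>2" by simp
      qed
      also have "\<dots> = measure M (space M) * B\<^sup>2" by simp
      also have "\<dots> \<le> 1 * B\<^sup>2" using M1 by (intro mult_right_mono) auto
      finally show "(\<integral>x. (w x * v k x)\<^sup>2 \<partial>M) \<le> B\<^sup>2" by simp
    qed simp
    finally have 1: "(\<integral>x. (G' x)\<^sup>2 \<partial>M) \<le> real (Suc N) * (B\<^sup>2 + 2)"
      by (simp add: algebra_simps)
    have "(\<integral>x. h n x * G' x \<partial>M) = (\<integral>x. h n x * G x \<partial>M) + \<sigma> * (\<integral>x. h n x * (w x * v k x) \<partial>M)" for n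
    proof -
      have "integrable M (\<lambda>x. h n x * G x)" "integrable M (\<lambda>x. h n x * (w x * v k x))"
        by (intro bdd_meas_integrable bdd_meas_intros v w G h)+
      moreover have "h n x * G' x = h n x * G x + \<sigma> * (h n x * (w x * v k x))" for x
        by (simp add: G'_def algebra_simps)
      ultimately show ?thesis by simp
    qed
    then have 2: "(\<lambda>n. \<integral>x. h n x * G' x \<partial>M) \<longlonglongrightarrow> l + \<sigma> * b k"
      by (simp only:) (intro tendsto_intros l b)
    have "real (Suc N) * \<delta> \<le> l + \<sigma> * b k"
      using l(2) k(2) by (simp add: \<sigma> algebra_simps)
    then show ?case using G' 1 2 by blast
  qed
  \<comment> \<open>With \<open>K * K\<close> summands, Young's inequality with weight
    \<open>K\<close> bounds the functional by \<open>K * (B\<^sup>2 + 3)\<close>, against the lower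
    bound \<open>K * K * \<delta>\<close>.\<close>
  obtain K where K: "(B\<^sup>2 + 3) / \<delta> < real K" using reals_Archimedean2 by blast
  have "0 \<le> (B\<^sup>2 + 3) / \<delta>" using \<delta> by simp
  then have K0: "0 < real K" using K by linarith
  obtain G l where G: "bdd_meas M G" "(\<integral>x. (G x)\<^sup>2 \<partial>M) \<le> real (K * K) * (B\<^sup>2 + 2)"
    and l: "(\<lambda>n. \<integral>x. h n x * G x \<partial>M) \<longlonglongrightarrow> l" "real (K * K) * \<delta> \<le> l" using ex by blast
  have "(\<integral>x. h n x * G x \<partial>M) \<le> K * (B\<^sup>2 + 3)" for n
  proof -
    have "\<bar>\<integral>x. h n x * G x \<partial>M\<bar> \<le> (\<integral>x. 1 / K * (G x)\<^sup>2 + K \<partial>M)"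
    proof (intro abs_integral_le bdd_meas_intros h G)
      fix x assume x: "x \<in> space M"
      have "\<bar>h n x * G x\<bar> \<le> 1 * \<bar>G x\<bar>" unfolding abs_mult using h(2)[OF x] by (intro mult_right_mono) auto
      also have "\<dots> \<le> 1 / K * (G x)\<^sup>2 + K"
        using mult_power_le[of "\<bar>G x\<bar>" 1 "real K" 1] K0 by (simp add: power2_eq_square)
      finally show "\<bar>h n x * G x\<bar> \<le> 1 / K * (G x)\<^sup>2 + K" .
    qed
    also have "\<dots> = 1 / K * (\<integral>x. (G x)\<^sup>2 \<partial>M) + measure M (space M) * K"
    proof -
      have "integrable M (\<lambda>x. (G x)\<^sup>2)" by (intro bdd_meas_integrable bdd_meas_intros G)
      then show ?thesis by simp
    qed
    also have "\<dots> \<le> 1 / K * (real (K * K) * (B\<^sup>2 + 2)) + 1 * K"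
      using G M1 K0 by (intro add_mono mult_left_mono mult_right_mono) auto
    also have "\<dots> = K * (B\<^sup>2 + 3)" using K0 by (simp add: field_simps)
    finally show ?thesis by linarith
  qed
  then have "l \<le> K * (B\<^sup>2 + 3)" by (intro LIMSEQ_le_const2[OF l(1)]) auto
  then have "K * (K * \<delta>) \<le> K * (B\<^sup>2 + 3)" using l(2) by (simp add: ac_simps)
  then have "K * \<delta> \<le> B\<^sup>2 + 3" using K0 by simp
  then show False using K \<delta> by (simp add: field_simps)
qed

end

section \<open>Almost multiplicative subsequences\<close>

text \<open>A countable family of test functions that contains the Riesz products of the \<open>v k\<close>
  restricted to the sets \<open>J t\<close>: entries \<open>(1, \<plusminus>1, k)\<close> are Riesz factors, and \<open>(0, 1, k)\<close> is \<open>v k\<close>.\<close>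
definition test_fun :: "(nat \<Rightarrow> 'a \<Rightarrow> real) \<Rightarrow> (nat \<Rightarrow> 'a set) \<Rightarrow> nat \<Rightarrow> (int \<times> int \<times> nat) list \<Rightarrow> 'a \<Rightarrow> real" where
  "test_fun v J t l x = indicator (J t) x * (\<Prod>(c, d, k)\<leftarrow>l. of_int c + of_int d * v k x)"

text \<open>A Riesz product over distinct indices below \<open>n\<close> has at most
  \<open>n\<close> factors; the extra place is for one more factor \<open>v k\<close>. Finiteness
  lets all conditions of stage \<open>n\<close> hold at once.\<close>

definition admissible :: "nat \<Rightarrow> (int \<times> int \<times> nat) list \<Rightarrow> bool" where
  "admissible n l \<longleftrightarrow> length l \<le> Suc n \<and> set l \<subseteq> {-1, 0, 1} \<times> {-1, 0, 1} \<times> {..<n}"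

text \<open>Integer coefficients keep the index type of the test functions countable, as the
  diagonal argument requires; the floor turns a real sign into an integer. \<open>k0\<close> counts
  the dropped initial terms.\<close>

fun riesz_list :: "nat \<Rightarrow> (nat \<Rightarrow> real) \<Rightarrow> nat \<Rightarrow> (int \<times> int \<times> nat) list" where
  "riesz_list k0 \<epsilon> 0 = []"
| "riesz_list k0 \<epsilon> (Suc m) = (1, \<lfloor>\<epsilon> m\<rfloor>, k0 + m) # riesz_list k0 \<epsilon> m"

lemma test_fun_Nil: "test_fun v J t [] x = indicator (J t) x"
  by (simp add: test_fun_def)

lemma test_fun_Cons:
  "test_fun v J t ((c, d, k) # l) x = (of_int c + of_int d * v k x) * test_fun v J t l x"
  by (simp add: test_fun_def)

lemma test_fun_reindex:
  "test_fun (\<lambda>n. v (r n)) J t l = test_fun v J t (map (\<lambda>(c, d, k). (c, d, r k)) l)"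
  by (rule ext) (simp add: test_fun_def o_def split_def)

lemma bdd_meas_test_fun:
  assumes "\<And>k. bdd_meas M (v k)" "\<And>t. J t \<in> sets M"
  shows "bdd_meas M (test_fun v J t l)"
proof (induction l)
  case Nil
  have "test_fun v J t [] = indicator (J t)" by (rule ext) (simp add: test_fun_Nil)
  then show ?case using assms by (simp add: bdd_meas_indicator)
next
  case (Cons z l)
  obtain c d k where z: "z = (c, d, k)" by (cases z)
  have "bdd_meas M (\<lambda>x. (of_int c + of_int d * v k x) * test_fun v J t l x)"
    by (intro bdd_meas_intros assms Cons)
  then show ?case by (simp add: z test_fun_Cons)
qed

lemma signs_floor: "\<epsilon> \<in> signs \<Longrightarrow> of_int \<lfloor>\<epsilon> i\<rfloor> = \<epsilon> i"
proof -
  assume "\<epsilon> \<in> signs"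
  then have "\<epsilon> i = 1 \<or> \<epsilon> i = -1" by (simp add: signs_def)
  then have "\<epsilon> i \<in> \<int>" by auto
  then show ?thesis by (elim Ints_cases) simp
qed

lemma test_fun_riesz_list:
  "\<epsilon> \<in> signs \<Longrightarrow> test_fun v J t (riesz_list k0 \<epsilon> m) x = indicator (J t) x * riesz m (\<lambda>i. v (k0 + i) x) \<epsilon>"
  by (induction m) (simp_all add: test_fun_Nil test_fun_Cons riesz_Suc signs_floor, simp add: riesz_def)

lemma length_riesz_list: "length (riesz_list k0 \<epsilon> m) = m"
  by (induction m) simp_all

lemma set_riesz_list: "\<epsilon> \<in> signs \<Longrightarrow> set (riesz_list k0 \<epsilon> m) \<subseteq> {-1, 0, 1} \<times> {-1, 0, 1} \<times> {..<k0 + m}"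
proof (induction m)
  case (Suc m)
  then have "\<epsilon> m = 1 \<or> \<epsilon> m = -1" by (simp add: signs_def)
  moreover have "\<lfloor>-1 :: real\<rfloor> = -1" by (simp add: floor_eq_iff)
  ultimately have "\<lfloor>\<epsilon> m\<rfloor> \<in> {-1, 0, 1}" by auto
  then show ?case using Suc by auto
qed simp

lemma admissible_riesz_list: "\<epsilon> \<in> signs \<Longrightarrow> admissible (k0 + m) (riesz_list k0 \<epsilon> m)"
  using set_riesz_list by (auto simp: admissible_def length_riesz_list)

lemma admissible_Cons_riesz_list:
  "\<epsilon> \<in> signs \<Longrightarrow> i < m \<Longrightarrow> admissible (k0 + m) ((0, 1, k0 + i) # riesz_list k0 \<epsilon> m)"
  using set_riesz_list[of \<epsilon> k0 m] by (auto simp: admissible_def length_riesz_list)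

lemma finite_admissible: "finite {l. admissible n l}"
proof -
  have "finite {l. set l \<subseteq> {-1, 0, 1::int} \<times> {-1, 0, 1::int} \<times> {..<n} \<and> length l \<le> Suc n}"
    by (intro finite_lists_length_le) auto
  then show ?thesis by (rule rev_finite_subset) (auto simp: admissible_def)
qed

locale bounded_weakly_null = finite_measure M for M :: "'a measure" +
  fixes u :: "nat \<Rightarrow> 'a \<Rightarrow> real" and J :: "nat \<Rightarrow> 'a set"
  assumes M1: "measure M (space M) \<le> 1"
    and u: "\<And>k. bdd_meas M (u k)" "\<And>k x. x \<in> space M \<Longrightarrow> \<bar>u k x\<bar> \<le> 1"
    and weak: "\<And>g. bdd_meas M g \<Longrightarrow> (\<lambda>k. \<integral>x. u k x * g x \<partial>M) \<longlonglongrightarrow> 0"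
    and J: "\<And>t. J t \<in> sets M"
begin

text \<open>\<open>\<Lambda> t l\<close> plays the part of the integral of the test function against
  the weak limit of the squares. The null property says that the subsequence stays weakly null for
  that limit and comes from \<open>limit_functional_weakly_null\<close>; the last clause is
  linearity in one factor.\<close>

lemma exists_square_limit_subsequence:
  "\<exists>r \<Lambda>. strict_mono (r :: nat \<Rightarrow> nat)
    \<and> (\<forall>t l. (\<lambda>n. \<integral>x. (u (r n) x)\<^sup>2 * test_fun (\<lambda>n. u (r n)) J t l x \<partial>M) \<longlonglongrightarrow> \<Lambda> t l)
    \<and> (\<forall>t l. (\<lambda>k. \<Lambda> t ((0, 1, k) # l)) \<longlonglongrightarrow> 0)
    \<and> (\<forall>t l e k. \<Lambda> t ((1, e, k) # l) = \<Lambda> t l + of_int e * \<Lambda> t ((0, 1, k) # l))"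
proof -
  define F where "F n z = (\<integral>x. (u n x)\<^sup>2 * test_fun u J (fst z) (snd z) x \<partial>M)" for n z
  have T: "bdd_meas M (test_fun u J t l)" for t l by (intro bdd_meas_test_fun u J)
  have sq: "\<bar>(u n x)\<^sup>2\<bar> \<le> 1" if "x \<in> space M" for n x
    using u(2)[OF that, of n] by (simp add: abs_square_le_1)
  have "\<bar>F n z\<bar> \<le> (\<integral>x. \<bar>test_fun u J (fst z) (snd z) x\<bar> \<partial>M)" for n z
    unfolding F_def
  proof (intro abs_integral_le bdd_meas_intros u T)
    fix x assume "x \<in> space M"
    then have "\<bar>(u n x)\<^sup>2\<bar> * \<bar>test_fun u J (fst z) (snd z) x\<bar> \<le> 1 * \<bar>test_fun u J (fst z) (snd z) x\<bar>"
      by (intro mult_right_mono sq) auto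
    then show "\<bar>(u n x)\<^sup>2 * test_fun u J (fst z) (snd z) x\<bar> \<le> \<bar>test_fun u J (fst z) (snd z) x\<bar>"
      by (simp add: abs_mult)
  qed
  then obtain r where r: "strict_mono r" and conv: "\<And>z. convergent (\<lambda>n. F (r n) z)"
    using diagonal_convergent_subsequence[of F "\<lambda>z. \<integral>x. \<bar>test_fun u J (fst z) (snd z) x\<bar> \<partial>M"] by blast
  define v where "v n = u (r n)" for n
  define \<Lambda> where "\<Lambda> t l = lim (\<lambda>n. \<integral>x. (v n x)\<^sup>2 * test_fun v J t l x \<partial>M)" for t l
  have v: "bdd_meas M (v k)" "\<And>x. x \<in> space M \<Longrightarrow> \<bar>v k x\<bar> \<le> 1" for k
    unfolding v_def by (intro u; assumption)+
  have Tv: "bdd_meas M (test_fun v J t l)" for t l by (intro bdd_meas_test_fun v J)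
  have \<Lambda>: "(\<lambda>n. \<integral>x. (v n x)\<^sup>2 * test_fun v J t l x \<partial>M) \<longlonglongrightarrow> \<Lambda> t l" for t l
  proof -
    \<comment> \<open>Test functions of the subsequence are test functions of \<open>u\<close> with
      renumbered entries, so one diagonal choice made for \<open>u\<close> covers them.\<close>
    have "test_fun v J t l = test_fun u J t (map (\<lambda>(c, d, k). (c, d, r k)) l)"
      using test_fun_reindex[of u r J t l] by (simp add: v_def[abs_def])
    then have "convergent (\<lambda>n. \<integral>x. (v n x)\<^sup>2 * test_fun v J t l x \<partial>M)"
      using conv[of "(t, map (\<lambda>(c, d, k). (c, d, r k)) l)"] by (simp add: F_def v_def)
    then show ?thesis unfolding \<Lambda>_def by (simp add: convergent_LIMSEQ_iff)
  qed
  have null: "(\<lambda>k. \<Lambda> t ((0, 1, k) # l)) \<longlonglongrightarrow> 0" for t l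
  proof (rule limit_functional_weakly_null[where v=v and h="\<lambda>n x. (v n x)\<^sup>2" and w="test_fun v J t l"])
    show "\<bar>(v n x)\<^sup>2\<bar> \<le> 1" if "x \<in> space M" for n x unfolding v_def by (rule sq[OF that])
    show "(\<lambda>k. \<integral>x. v k x * g x \<partial>M) \<longlonglongrightarrow> 0" if "bdd_meas M g" for g
      using LIMSEQ_subseq_LIMSEQ[OF weak[OF that] r] by (simp add: v_def o_def)
    show "(\<lambda>n. \<integral>x. (v n x)\<^sup>2 * (test_fun v J t l x * v k x) \<partial>M) \<longlonglongrightarrow> \<Lambda> t ((0, 1, k) # l)" for k
      using \<Lambda>[of t "(0, 1, k) # l"] by (simp add: test_fun_Cons mult.commute)
  qed (intro M1 v Tv bdd_meas_intros; assumption)+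
  have add: "\<Lambda> t ((1, e, k) # l) = \<Lambda> t l + of_int e * \<Lambda> t ((0, 1, k) # l)" for t l e k
  proof (rule LIMSEQ_unique[OF \<Lambda>])
    have "(\<integral>x. (v n x)\<^sup>2 * test_fun v J t ((1, e, k) # l) x \<partial>M)
      = (\<integral>x. (v n x)\<^sup>2 * test_fun v J t l x \<partial>M)
        + of_int e * (\<integral>x. (v n x)\<^sup>2 * test_fun v J t ((0, 1, k) # l) x \<partial>M)" for n
    proof -
      have "integrable M (\<lambda>x. (v n x)\<^sup>2 * test_fun v J t l x)"
        "integrable M (\<lambda>x. (v n x)\<^sup>2 * test_fun v J t ((0, 1, k) # l) x)"
        by (intro bdd_meas_integrable bdd_meas_intros v Tv)+
      moreover have "(v n x)\<^sup>2 * test_fun v J t ((1, e, k) # l) x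
        = (v n x)\<^sup>2 * test_fun v J t l x + of_int e * ((v n x)\<^sup>2 * test_fun v J t ((0, 1, k) # l) x)" for x
        by (simp add: test_fun_Cons algebra_simps)
      ultimately show ?thesis by simp
    qed
    then show "(\<lambda>n. \<integral>x. (v n x)\<^sup>2 * test_fun v J t ((1, e, k) # l) x \<partial>M)
      \<longlonglongrightarrow> \<Lambda> t l + of_int e * \<Lambda> t ((0, 1, k) # l)"
      by (simp only:) (intro tendsto_intros \<Lambda>)
  qed
  have v_eta: "v = (\<lambda>n. u (r n))" by (rule ext) (simp add: v_def)
  show ?thesis
  proof (intro exI[of _ r] exI[of _ \<Lambda>] conjI allI r)
    show "(\<lambda>n. \<integral>x. (u (r n) x)\<^sup>2 * test_fun (\<lambda>n. u (r n)) J t l x \<partial>M) \<longlonglongrightarrow> \<Lambda> t l" for t l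
      using \<Lambda>[of t l] unfolding v_eta .
  qed (rule null add)+
qed

text \<open>For a fixed list the three quantities are eventually small: by weak nullity, by the
  definition of the limit, and by the null property. Stage \<open>n\<close> imposes them on finitely
  many lists over earlier terms, with summable errors. \<open>r\<close> is kept because
  \<open>\<Lambda> t []\<close> is a limit along \<open>r\<close>.\<close>

lemma exists_almost_multiplicative_subsequence:
  "\<exists>s r \<Lambda>. strict_mono (s :: nat \<Rightarrow> nat) \<and> strict_mono (r :: nat \<Rightarrow> nat)
    \<and> (\<forall>t. (\<lambda>n. \<integral>x. (u (r n) x)\<^sup>2 * indicator (J t) x \<partial>M) \<longlonglongrightarrow> \<Lambda> t [])
    \<and> (\<forall>t l e k. \<Lambda> t ((1, e, k) # l) = \<Lambda> t l + of_int e * \<Lambda> t ((0, 1, k) # l))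
    \<and> (\<forall>n t l. t \<le> n \<longrightarrow> admissible n l \<longrightarrow>
        \<bar>\<integral>x. u (s n) x * test_fun (\<lambda>n. u (s n)) J t l x \<partial>M\<bar> \<le> (1/2) ^ n
      \<and> \<bar>(\<integral>x. (u (s n) x)\<^sup>2 * test_fun (\<lambda>n. u (s n)) J t l x \<partial>M) - \<Lambda> t l\<bar> \<le> (1/2) ^ n
      \<and> \<bar>\<Lambda> t ((0, 1, n) # l)\<bar> \<le> (1/2) ^ n)"
proof -
  from exists_square_limit_subsequence obtain r \<Lambda>' where r: "strict_mono (r :: nat \<Rightarrow> nat)"
    and lim: "\<And>t l. (\<lambda>n. \<integral>x. (u (r n) x)\<^sup>2 * test_fun (\<lambda>n. u (r n)) J t l x \<partial>M) \<longlonglongrightarrow> \<Lambda>' t l"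
    and null: "\<And>t l. (\<lambda>k. \<Lambda>' t ((0, 1, k) # l)) \<longlonglongrightarrow> 0"
    and add: "\<And>t l e k. \<Lambda>' t ((1, e, k) # l) = \<Lambda>' t l + of_int e * \<Lambda>' t ((0, 1, k) # l)"
    by blast
  define v where "v n = u (r n)" for n
  have v: "bdd_meas M (v k)" for k unfolding v_def by (rule u)
  define re where "re s = (\<lambda>(c :: int, d :: int, k). (c, d, s k :: nat))" for s :: "nat \<Rightarrow> nat"
  define good where "good \<delta> t l k \<longleftrightarrow>
        \<bar>\<integral>x. v k x * test_fun v J t l x \<partial>M\<bar> \<le> \<delta>
      \<and> \<bar>(\<integral>x. (v k x)\<^sup>2 * test_fun v J t l x \<partial>M) - \<Lambda>' t l\<bar> \<le> \<delta>
      \<and> \<bar>\<Lambda>' t ((0, 1, k) # l)\<bar> \<le> \<delta>" for \<delta> t l k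
  have ev: "eventually (good \<delta> t l) sequentially" if "0 < \<delta>" for \<delta> t l
  proof -
    have "eventually (\<lambda>n. \<bar>X n - a\<bar> \<le> \<delta>) sequentially" if "X \<longlonglongrightarrow> a" for X and a :: real
    proof -
      have "eventually (\<lambda>n. dist (X n) a < \<delta>) sequentially" using tendstoD[OF that \<open>0 < \<delta>\<close>] .
      then show ?thesis by eventually_elim (simp add: dist_real_def)
    qed
    note small = this
    have "bdd_meas M (test_fun v J t l)" by (intro bdd_meas_test_fun v J)
    then have "(\<lambda>k. \<integral>x. v k x * test_fun v J t l x \<partial>M) \<longlonglongrightarrow> 0"
      using LIMSEQ_subseq_LIMSEQ[OF weak r, of "test_fun v J t l"] by (simp add: v_def o_def)
    from small[OF this] small[OF lim[of t l]] small[OF null[of t l]] show ?thesis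
      unfolding good_def v_def by eventually_elim simp
  qed
  \<comment> \<open>\<open>xs\<close> records the terms already chosen. Entries of \<open>l\<close>
    are positions in the new sequence, which \<open>re ((!) xs)\<close> translates into indices of
    \<open>v\<close>.\<close>
  define Q where "Q xs k \<longleftrightarrow> (\<forall>t\<in>{..length xs}. \<forall>l\<in>{l. admissible (length xs) l}.
      good ((1/2) ^ length xs) t (map (re ((!) xs)) l) k)" for xs k
  have "eventually (Q xs) sequentially" for xs
    unfolding Q_def[abs_def]
    by (intro eventually_ball_finite ballI ev finite_admissible finite_atMost) auto
  from exists_strict_mono_selection[of Q, OF this]
  obtain s where s: "strict_mono s" and Q: "\<And>n. Q (map s [0..<n]) (s n)" by blast
  have good: "good ((1/2) ^ n) t (map (re s) l) (s n)" if "t \<le> n" "admissible n l" for n t l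
  proof -
    \<comment> \<open>Admissible lists mention only positions below \<open>n\<close>, where the
      recorded history agrees with \<open>s\<close>.\<close>
    have "map (re ((!) (map s [0..<n]))) l = map (re s) l"
      using that(2) by (intro map_cong refl) (auto simp: re_def admissible_def)
    moreover have "good ((1/2) ^ n) t (map (re ((!) (map s [0..<n]))) l) (s n)"
      using Q[of n] that unfolding Q_def by simp
    ultimately show ?thesis by (simp only:)
  qed
  define \<Lambda> where "\<Lambda> t l = \<Lambda>' t (map (re s) l)" for t l
  have test: "test_fun (\<lambda>n. u (r (s n))) J t l = test_fun v J t (map (re s) l)" for t l
    using test_fun_reindex[of v s J t l] by (simp add: v_def[abs_def] re_def)
  show ?thesis
  proof (rule exI[of _ "\<lambda>n. r (s n)"], rule exI[of _ r], rule exI[of _ \<Lambda>], intro conjI allI impI)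
    show "strict_mono (\<lambda>n. r (s n))" using strict_mono_o[OF r s] by (simp add: o_def)
    show "strict_mono r" by (rule r)
    show "(\<lambda>n. \<integral>x. (u (r n) x)\<^sup>2 * indicator (J t) x \<partial>M) \<longlonglongrightarrow> \<Lambda> t []" for t
      using lim[of t "[]"] by (simp add: test_fun_Nil \<Lambda>_def)
    show "\<Lambda> t ((1, e, k) # l) = \<Lambda> t l + of_int e * \<Lambda> t ((0, 1, k) # l)" for t l e k
      using add by (simp add: \<Lambda>_def re_def)
    fix n t l assume *: "t \<le> n" "admissible n l"
    note g = good[OF *, unfolded good_def]
    show "\<bar>\<integral>x. u (r (s n)) x * test_fun (\<lambda>n. u (r (s n))) J t l x \<partial>M\<bar> \<le> (1/2) ^ n"
      "\<bar>(\<integral>x. (u (r (s n)) x)\<^sup>2 * test_fun (\<lambda>n. u (r (s n))) J t l x \<partial>M) - \<Lambda> t l\<bar> \<le> (1/2) ^ n"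
      "\<bar>\<Lambda> t ((0, 1, n) # l)\<bar> \<le> (1/2) ^ n"
      using g by (simp_all only: test) (simp_all add: \<Lambda>_def v_def re_def)
  qed
qed

end

lemma telescope_bound:
  fixes f :: "nat \<Rightarrow> real"
  assumes step: "\<And>j. m \<le> j \<Longrightarrow> j < n \<Longrightarrow> \<bar>f (Suc j) - f j\<bar> \<le> (1/2) ^ (k + j)" and mn: "m \<le> n"
  shows "\<bar>f n - f m\<bar> \<le> 2 * (1/2) ^ (k + m)"
proof -
  have "\<bar>f n - f m\<bar> \<le> 2 * (1/2) ^ (k + m) - 2 * (1/2) ^ (k + n)"
    using mn step
  proof (induction n rule: dec_induct)
    case (step n)
    have "\<bar>f n - f m\<bar> \<le> 2 * (1/2) ^ (k + m) - 2 * (1/2) ^ (k + n)"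
      using step.prems by (intro step.IH) auto
    moreover have "\<bar>f (Suc n) - f n\<bar> \<le> (1/2) ^ (k + n)" using step by auto
    moreover have "2 * (1/2::real) ^ (k + Suc n) = (1/2) ^ (k + n)" by simp
    ultimately show ?case by linarith
  qed simp
  moreover have "0 \<le> 2 * (1/2::real) ^ (k + n)" by simp
  ultimately show ?thesis by linarith
qed

lemma sum_half_powers_le: "(\<Sum>i<m. (1/2::real) ^ (k + i)) \<le> 2 * (1/2) ^ k"
  by (simp add: power_add sum_distrib_left[symmetric] sum_gp_strict)

section \<open>Moment comparison along the selected subsequence\<close>

context bounded_weakly_null
begin

text \<open>A new Riesz factor changes the relevant integrals by a term of a geometric series. After
  \<open>k0\<close> terms are dropped, all perturbations are small against \<open>c\<close>, the
  limiting integral of the squares over \<open>J t\<close>.\<close>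

lemma exists_subsequence_moment_comparison:
  assumes J0: "J 0 = space M"
    and nondeg: "\<And>t. \<exists>c>0. eventually (\<lambda>k. c \<le> (\<integral>x. (u k x)\<^sup>2 * indicator (J t) x \<partial>M)) sequentially"
  shows "\<exists>s. strict_mono (s :: nat \<Rightarrow> nat) \<and> (\<forall>t. \<exists>k0 \<kappa>. 0 < \<kappa> \<and> (\<forall>m a p. even p \<longrightarrow> 0 < p \<longrightarrow>
      (\<integral>x. (\<Sum>i<m. a i * u (s (k0 + i)) x) ^ p \<partial>M) \<le> 2 * rad_mean m (\<lambda>\<epsilon>. rad_sum m a \<epsilon> ^ p)
    \<and> \<kappa> ^ p * rad_mean m (\<lambda>\<epsilon>. rad_sum m a \<epsilon> ^ p)
        \<le> (\<integral>x. indicator (J t) x * (\<Sum>i<m. a i * u (s (k0 + i)) x) ^ p \<partial>M)))"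
proof -
  from exists_almost_multiplicative_subsequence
  obtain s r \<Lambda> where s: "strict_mono (s :: nat \<Rightarrow> nat)" and r: "strict_mono (r :: nat \<Rightarrow> nat)"
    and lim: "\<And>t. (\<lambda>n. \<integral>x. (u (r n) x)\<^sup>2 * indicator (J t) x \<partial>M) \<longlonglongrightarrow> \<Lambda> t []"
    and add: "\<And>t l e k. \<Lambda> t ((1, e, k) # l) = \<Lambda> t l + of_int e * \<Lambda> t ((0, 1, k) # l)"
    and err: "\<And>n t l. t \<le> n \<Longrightarrow> admissible n l \<Longrightarrow>
        \<bar>\<integral>x. u (s n) x * test_fun (\<lambda>n. u (s n)) J t l x \<partial>M\<bar> \<le> (1/2) ^ n
      \<and> \<bar>(\<integral>x. (u (s n) x)\<^sup>2 * test_fun (\<lambda>n. u (s n)) J t l x \<partial>M) - \<Lambda> t l\<bar> \<le> (1/2) ^ n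
      \<and> \<bar>\<Lambda> t ((0, 1, n) # l)\<bar> \<le> (1/2) ^ n"
    by blast
  define \<phi> where "\<phi> n = u (s n)" for n
  have \<phi>: "bdd_meas M (\<phi> n)" "\<And>x. x \<in> space M \<Longrightarrow> \<bar>\<phi> n x\<bar> \<le> 1" for n
    unfolding \<phi>_def by (intro u; assumption)+
  have T: "bdd_meas M (test_fun \<phi> J t l)" for t l by (intro bdd_meas_test_fun \<phi> J)
  have err: "\<bar>\<integral>x. \<phi> n x * test_fun \<phi> J t l x \<partial>M\<bar> \<le> (1/2) ^ n"
      "\<bar>(\<integral>x. (\<phi> n x)\<^sup>2 * test_fun \<phi> J t l x \<partial>M) - \<Lambda> t l\<bar> \<le> (1/2) ^ n"
      "\<bar>\<Lambda> t ((0, 1, n) # l)\<bar> \<le> (1/2) ^ n" if "t \<le> n" "admissible n l" for n t l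
    using err[OF that] by (simp_all add: \<phi>_def[abs_def])
  have "\<exists>k0 \<kappa>. 0 < \<kappa> \<and> (\<forall>m a p. even p \<longrightarrow> 0 < p \<longrightarrow>
      (\<integral>x. (\<Sum>i<m. a i * \<phi> (k0 + i) x) ^ p \<partial>M) \<le> 2 * rad_mean m (\<lambda>\<epsilon>. rad_sum m a \<epsilon> ^ p)
    \<and> \<kappa> ^ p * rad_mean m (\<lambda>\<epsilon>. rad_sum m a \<epsilon> ^ p)
        \<le> (\<integral>x. indicator (J t) x * (\<Sum>i<m. a i * \<phi> (k0 + i) x) ^ p \<partial>M))" for t
  proof -
    define c where "c = \<Lambda> t []"
    have c: "0 < c"
    proof -
      obtain c' where c': "0 < c'" "eventually (\<lambda>k. c' \<le> (\<integral>x. (u k x)\<^sup>2 * indicator (J t) x \<partial>M)) sequentially"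
        using nondeg by blast
      have "eventually (\<lambda>n. c' \<le> (\<integral>x. (u (r n) x)\<^sup>2 * indicator (J t) x \<partial>M)) sequentially"
        by (rule eventually_subseq[OF r c'(2)])
      then have "c' \<le> c" unfolding c_def
        by (intro tendsto_lowerbound[OF lim]) auto
      then show ?thesis using c' by simp
    qed
    \<comment> \<open>96 is 8 times 12: the errors \<open>6 * (1/2) ^ (k0 + i)\<close> sum to at
      most \<open>12 * (1/2) ^ k0\<close>, which must not exceed \<open>c / 8\<close>.\<close>
    obtain k1 where k1: "(1/2) ^ k1 < c / 96" using real_arch_pow_inv[of "c / 96" "1/2"] c by auto
    \<comment> \<open>\<open>Suc\<close> forces \<open>(1/2) ^ k0 \<le> 1/2\<close>, for the mass
      bound 2; the maximum with \<open>t\<close> puts \<open>J t\<close> among the sets controlled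
      at every later stage.\<close>
    define k0 where "k0 = Suc (max k1 t)"
    have "(1/2::real) ^ k0 \<le> (1/2) ^ k1" by (intro power_decreasing) (auto simp: k0_def)
    then have k0c: "(1/2) ^ k0 \<le> c / 96" using k1 by linarith
    have "(1/2::real) ^ k0 \<le> (1/2) ^ 1" by (intro power_decreasing) (auto simp: k0_def)
    then have k0half: "(1/2::real) ^ k0 \<le> 1/2" by simp
    have tk: "t \<le> k0 + j" for j by (simp add: k0_def)
    define P where "P t m \<epsilon> = test_fun \<phi> J t (riesz_list k0 \<epsilon> m)" for t m \<epsilon>
    have P: "bdd_meas M (P t m \<epsilon>)" for t m \<epsilon> unfolding P_def by (rule T)
    have P_riesz: "P t m \<epsilon> x = indicator (J t) x * riesz m (\<lambda>i. \<phi> (k0 + i) x) \<epsilon>" if "\<epsilon> \<in> signs" for t m \<epsilon> x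
      unfolding P_def by (rule test_fun_riesz_list[OF that])
    have P_Suc: "(\<integral>x. w x * P t (Suc j) \<epsilon> x \<partial>M)
        = (\<integral>x. w x * P t j \<epsilon> x \<partial>M) + \<epsilon> j * (\<integral>x. \<phi> (k0 + j) x * (w x * P t j \<epsilon> x) \<partial>M)"
      if "\<epsilon> \<in> signs" "bdd_meas M w" for t j \<epsilon> w
    proof -
      have "integrable M (\<lambda>x. w x * P t j \<epsilon> x)" "integrable M (\<lambda>x. \<phi> (k0 + j) x * (w x * P t j \<epsilon> x))"
        by (intro bdd_meas_integrable bdd_meas_intros P \<phi> that)+
      moreover have "w x * P t (Suc j) \<epsilon> x = w x * P t j \<epsilon> x + \<epsilon> j * (\<phi> (k0 + j) x * (w x * P t j \<epsilon> x))" for x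
        using that by (simp add: P_def test_fun_Cons signs_floor algebra_simps)
      ultimately show ?thesis by simp
    qed
    \<comment> \<open>The factor number \<open>j\<close> changes the mass over the whole space by at
      most \<open>(1/2) ^ (k0 + j)\<close>, hence all factors together change it by at most
      1.\<close>
    have U: "(\<integral>x. riesz m (\<lambda>i. \<phi> (k0 + i) x) \<epsilon> \<partial>M) \<le> 2" if \<epsilon>: "\<epsilon> \<in> signs" for m \<epsilon>
    proof -
      have "\<bar>(\<integral>x. P 0 (Suc j) \<epsilon> x \<partial>M) - (\<integral>x. P 0 j \<epsilon> x \<partial>M)\<bar> \<le> (1/2) ^ (k0 + j)" for j
        using P_Suc[OF \<epsilon> bdd_meas_const[of M 1], of 0 j]
          err(1)[of 0 "k0 + j" "riesz_list k0 \<epsilon> j"] admissible_riesz_list[OF \<epsilon>]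
        by (simp add: P_def[symmetric] abs_mult signs_abs[OF \<epsilon>])
      then have "\<bar>(\<integral>x. P 0 m \<epsilon> x \<partial>M) - (\<integral>x. P 0 0 \<epsilon> x \<partial>M)\<bar> \<le> 2 * (1/2) ^ (k0 + 0)"
        by (intro telescope_bound) auto
      moreover have "(\<integral>x. P 0 m \<epsilon> x \<partial>M) = (\<integral>x. riesz m (\<lambda>i. \<phi> (k0 + i) x) \<epsilon> \<partial>M)"
        by (intro Bochner_Integration.integral_cong refl) (simp add: P_riesz[OF \<epsilon>] J0)
      moreover have "(\<integral>x. P 0 0 \<epsilon> x \<partial>M) = measure M (space M)"
        using J[of 0] by (simp add: P_def test_fun_Nil[abs_def] J0)
      ultimately show ?thesis using M1 k0half by simp
    qed
    \<comment> \<open>The factors enter one at a time. Before factor \<open>i\<close> the integral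
      is small; factor \<open>i\<close> creates a square and so
      \<open>\<epsilon> i * \<Lambda>\<close> of the first \<open>i\<close> factors; later factors
      hardly change either the integral or \<open>\<Lambda>\<close>. The errors add up to 5 times
      \<open>(1/2) ^ (k0 + i)\<close>.\<close>
    have L: "\<bar>(\<integral>x. indicator (J t) x * (\<phi> (k0 + i) x * riesz m (\<lambda>i. \<phi> (k0 + i) x) \<epsilon>) \<partial>M)
        - \<epsilon> i * \<Lambda> t (riesz_list k0 \<epsilon> m)\<bar> \<le> 6 * (1/2) ^ (k0 + i)"
      and l: "c / 2 \<le> \<Lambda> t (riesz_list k0 \<epsilon> m)" if \<epsilon>: "\<epsilon> \<in> signs" and i: "i < m" for \<epsilon> i m
    proof -
      define A where "A j = \<Lambda> t (riesz_list k0 \<epsilon> j)" for j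
      define I where "I j = (\<integral>x. \<phi> (k0 + i) x * P t j \<epsilon> x \<partial>M)" for j
      have A_step: "\<bar>A (Suc j) - A j\<bar> \<le> (1/2) ^ (k0 + j)" for j
        using err(3)[OF tk[of j] admissible_riesz_list[OF \<epsilon>, of k0 j]]
        by (simp add: A_def add signs_floor[OF \<epsilon>] abs_mult signs_abs[OF \<epsilon>])
      have "\<bar>A m - A 0\<bar> \<le> 2 * (1/2) ^ (k0 + 0)" by (intro telescope_bound A_step) auto
      then show "c / 2 \<le> \<Lambda> t (riesz_list k0 \<epsilon> m)" using k0c c by (simp add: A_def c_def)
      have 1: "\<bar>A m - A i\<bar> \<le> 2 * (1/2) ^ (k0 + i)" using i by (intro telescope_bound A_step) auto
      have "\<bar>I (Suc j) - I j\<bar> \<le> (1/2) ^ (k0 + j)" if "i < j" for j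
        using P_Suc[OF \<epsilon> \<phi>(1)[of "k0 + i"], of t j]
          err(1)[OF tk[of j] admissible_Cons_riesz_list[OF \<epsilon> that, of k0]]
        by (simp add: I_def P_def[symmetric] test_fun_Cons abs_mult signs_abs[OF \<epsilon>])
      then have "\<bar>I m - I (Suc i)\<bar> \<le> 2 * (1/2) ^ (k0 + Suc i)"
        using i by (intro telescope_bound) auto
      then have 2: "\<bar>I m - I (Suc i)\<bar> \<le> (1/2) ^ (k0 + i)" by simp
      have 3: "\<bar>I (Suc i) - \<epsilon> i * A i\<bar> \<le> 2 * (1/2) ^ (k0 + i)"
      proof -
        note a = tk[of i] admissible_riesz_list[OF \<epsilon>, of k0 i]
        define S where "S = (\<integral>x. (\<phi> (k0 + i) x)\<^sup>2 * P t i \<epsilon> x \<partial>M)"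
        have "I (Suc i) = I i + \<epsilon> i * S"
          using P_Suc[OF \<epsilon> \<phi>(1)[of "k0 + i"], of t i]
          by (simp add: I_def S_def power2_eq_square mult.assoc)
        then have "I (Suc i) - \<epsilon> i * A i = I i + \<epsilon> i * (S - A i)" by (simp add: algebra_simps)
        also have "\<bar>\<dots>\<bar> \<le> \<bar>I i\<bar> + \<bar>S - A i\<bar>"
          by (intro order_trans[OF abs_triangle_ineq]) (simp add: abs_mult signs_abs[OF \<epsilon>])
        also have "\<dots> \<le> (1/2) ^ (k0 + i) + (1/2) ^ (k0 + i)"
          using err(1)[OF a] err(2)[OF a] by (intro add_mono) (simp_all add: I_def S_def A_def P_def)
        finally show ?thesis by simp
      qed
      have "\<bar>\<epsilon> i * A i - \<epsilon> i * A m\<bar> = \<bar>A m - A i\<bar>"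
        by (simp add: right_diff_distrib[symmetric] abs_mult signs_abs[OF \<epsilon>] abs_minus_commute)
      with 1 2 3 have "\<bar>I m - \<epsilon> i * A m\<bar> \<le> 6 * (1/2) ^ (k0 + i)" by linarith
      moreover have "I m = (\<integral>x. indicator (J t) x * (\<phi> (k0 + i) x * riesz m (\<lambda>i. \<phi> (k0 + i) x) \<epsilon>) \<partial>M)"
        unfolding I_def by (intro Bochner_Integration.integral_cong refl) (simp add: P_riesz[OF \<epsilon>])
      ultimately show "\<bar>(\<integral>x. indicator (J t) x * (\<phi> (k0 + i) x * riesz m (\<lambda>i. \<phi> (k0 + i) x) \<epsilon>) \<partial>M)
          - \<epsilon> i * \<Lambda> t (riesz_list k0 \<epsilon> m)\<bar> \<le> 6 * (1/2) ^ (k0 + i)"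
        by (simp add: A_def)
    qed
    have sum: "(\<Sum>i<m. 6 * (1/2) ^ (k0 + i)) \<le> c / 8" for m
      using sum_half_powers_le[where k=k0 and m=m] k0c by (simp add: sum_distrib_left[symmetric])
    \<comment> \<open>The estimates above assume some \<open>i < m\<close>; the empty product is
      treated separately and gives \<open>c\<close> itself.\<close>
    have l': "c / 2 \<le> \<Lambda> t (riesz_list k0 \<epsilon> m)" if "\<epsilon> \<in> signs" for \<epsilon> m
      using l[OF that, of 0 m] c by (cases m) (auto simp: c_def)
    show ?thesis
    proof (rule exI[of _ k0], rule exI[of _ "c / 16"], intro conjI allI impI)
      show "0 < c / 16" using c by simp
      fix m a and p :: nat assume p: "even p" "0 < p"
      show "(\<integral>x. (\<Sum>i<m. a i * \<phi> (k0 + i) x) ^ p \<partial>M) \<le> 2 * rad_mean m (\<lambda>\<epsilon>. rad_sum m a \<epsilon> ^ p)"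
        by (intro moment_le_rad_mean \<phi> U p)
      show "(c / 16) ^ p * rad_mean m (\<lambda>\<epsilon>. rad_sum m a \<epsilon> ^ p)
        \<le> (\<integral>x. indicator (J t) x * (\<Sum>i<m. a i * \<phi> (k0 + i) x) ^ p \<partial>M)"
        using c p
        by (intro rad_mean_le_moment[where l="\<lambda>\<epsilon>. \<Lambda> t (riesz_list k0 \<epsilon> m)"
              and e="\<lambda>i. 6 * (1/2) ^ (k0 + i)"] \<phi> U J L l' sum) auto
    qed
  qed
  then show ?thesis using s unfolding \<phi>_def by blast
qed

end

section \<open>The Rademacher system on the unit interval\<close>

text \<open>Halving the interval fixes the leading sign, whereas \<open>rad_mean\<close> peels off
  the last one; this passes between the two ends.\<close>

lemma rad_mean_front:
  "rad_mean (Suc m) F = (rad_mean m (\<lambda>\<epsilon>. F (case_nat 1 \<epsilon>)) + rad_mean m (\<lambda>\<epsilon>. F (case_nat (-1) \<epsilon>))) / 2"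
proof (induction m arbitrary: F)
  case 0
  have "(case_nat y (\<lambda>_. 1) :: nat \<Rightarrow> real) = (\<lambda>_. 1)(0 := y)" for y
    by (auto split: nat.split)
  then show ?case by simp
next
  case (Suc m)
  have upd: "(case_nat y \<epsilon>)(Suc m := z) = case_nat y (\<epsilon>(m := z))" for y z and \<epsilon> :: "nat \<Rightarrow> real"
    by (auto split: nat.split)
  have "rad_mean (Suc (Suc m)) F = (rad_mean (Suc m) (\<lambda>\<epsilon>. F (\<epsilon>(Suc m := 1)))
      + rad_mean (Suc m) (\<lambda>\<epsilon>. F (\<epsilon>(Suc m := -1)))) / 2"
    by (rule rad_mean.simps)
  also have "\<dots> = ((rad_mean m (\<lambda>\<epsilon>. F (case_nat 1 (\<epsilon>(m := 1)))) + rad_mean m (\<lambda>\<epsilon>. F (case_nat (-1) (\<epsilon>(m := 1))))) / 2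
      + (rad_mean m (\<lambda>\<epsilon>. F (case_nat 1 (\<epsilon>(m := -1)))) + rad_mean m (\<lambda>\<epsilon>. F (case_nat (-1) (\<epsilon>(m := -1))))) / 2) / 2"
    unfolding Suc.IH upd ..
  also have "\<dots> = (rad_mean (Suc m) (\<lambda>\<epsilon>. F (case_nat 1 \<epsilon>)) + rad_mean (Suc m) (\<lambda>\<epsilon>. F (case_nat (-1) \<epsilon>))) / 2"
    by (simp add: add_divide_distrib)
  finally show ?case .
qed

lemma rad_mean_reflect:
  "rad_mean m (\<lambda>\<epsilon>. G (c - rad_sum m a \<epsilon>)) = rad_mean m (\<lambda>\<epsilon>. G (c + rad_sum m a \<epsilon>))"
proof (induction m arbitrary: c)
  case (Suc m)
  have "rad_mean (Suc m) (\<lambda>\<epsilon>. G (c - rad_sum (Suc m) a \<epsilon>))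
    = (rad_mean m (\<lambda>\<epsilon>. G ((c - a m) - rad_sum m a \<epsilon>)) + rad_mean m (\<lambda>\<epsilon>. G ((c + a m) - rad_sum m a \<epsilon>))) / 2"
    by (simp add: rad_sum_Suc algebra_simps)
  also have "\<dots> = rad_mean (Suc m) (\<lambda>\<epsilon>. G (c + rad_sum (Suc m) a \<epsilon>))"
    unfolding Suc by (simp add: rad_sum_Suc algebra_simps)
  finally show ?case .
qed (simp add: rad_sum_def)

lemma rad_sum_case_nat: "rad_sum (Suc m) a (case_nat y \<epsilon>) = a 0 * y + rad_sum m (a \<circ> Suc) \<epsilon>"
  unfolding rad_sum_def sum.lessThan_Suc_shift by simp

text \<open>For even \<open>G\<close> a negative first sign can be moved to the rest of the sum,
  whose distribution is symmetric.\<close>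

lemma rad_mean_even_front:
  assumes "\<And>y. G (- y) = G y"
  shows "rad_mean (Suc m) (\<lambda>\<epsilon>. G (rad_sum (Suc m) a \<epsilon>)) = rad_mean m (\<lambda>\<epsilon>. G (a 0 + rad_sum m (a \<circ> Suc) \<epsilon>))"
proof -
  have "G (- a 0 + s) = G (a 0 - s)" for s
    using assms[of "a 0 - s"] by simp
  then show ?thesis
    using rad_mean_reflect[of m G "a 0" "a \<circ> Suc"] unfolding rad_mean_front rad_sum_case_nat by simp
qed

lemma rademacher_half: "rademacher (Suc (Suc n)) (x / 2) = rademacher (Suc n) x"
  by (simp add: rademacher_def mult.assoc)

text \<open>The shift by 1/2 adds the phase \<open>2 ^ n * pi\<close>: half a period for
  \<open>n = 0\<close>, whole periods otherwise.\<close>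

lemma rademacher_half_shift:
  "rademacher (Suc (Suc n)) (1 / 2 + x / 2) = (if n = 0 then - 1 else 1) * rademacher (Suc n) x"
proof (cases n)
  case 0
  have "sin (pi * x + pi) = - sin (pi * x)" by simp
  then show ?thesis using 0 by (simp add: rademacher_def algebra_simps sgn_minus)
next
  case (Suc k)
  have "2 ^ Suc (Suc k) * pi * (1 / 2 + x / 2) = 2 ^ Suc k * pi * x + 2 * pi * of_int (2 ^ k)"
    by (simp add: algebra_simps)
  then have "sin (2 ^ Suc (Suc k) * pi * (1 / 2 + x / 2)) = sin (2 ^ Suc k * pi * x)"
    by (simp only: sin_add sin_int_2pin cos_int_2pin mult_1_right mult_zero_right add_0_right)
  then show ?thesis using Suc by (simp add: rademacher_def)
qed

text \<open>With this indexing the first function of the system is not a fair sign. This is harmless because only even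
  functions of the sums matter: see \<open>rad_mean_even_front\<close>.\<close>
lemma rademacher_first: "0 < x \<Longrightarrow> x < 1 \<Longrightarrow> rademacher (Suc 0) x = 1"
  using sin_gt_zero[of "pi * x"] by (simp add: rademacher_def)

lemma rademacher_measurable [measurable]: "rademacher n \<in> borel_measurable borel"
  unfolding rademacher_def[abs_def] by measurable

lemma abs_rademacher_le: "\<bar>rademacher n x\<bar> \<le> 1"
  by (simp add: rademacher_def sgn_if)

lemma integrable_indicator_power_rademacher:
  "integrable lborel (\<lambda>x. indicator {c..d} x * (\<Sum>n<m. b n * rademacher (Suc n) x) ^ p)"
proof -
  have "\<bar>\<Sum>n<m. b n * rademacher (Suc n) x\<bar> \<le> (\<Sum>n<m. \<bar>b n\<bar>)" for x
    by (intro order_trans[OF sum_abs] sum_mono)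
      (use abs_rademacher_le in \<open>auto simp: abs_mult intro: mult_left_le\<close>)
  then have bound: "\<bar>(\<Sum>n<m. b n * rademacher (Suc n) x) ^ p\<bar> \<le> (\<Sum>n<m. \<bar>b n\<bar>) ^ p" for x
    unfolding power_abs by (intro power_mono) auto
  show ?thesis
  proof (rule Bochner_Integration.integrable_bound[where f="\<lambda>x. indicator {c..d} x * (\<Sum>n<m. \<bar>b n\<bar>) ^ p"])
    show "integrable lborel (\<lambda>x. indicator {c..d} x * (\<Sum>n<m. \<bar>b n\<bar>) ^ p)"
      by (intro integrable_mult_left integrable_real_indicator) (auto simp: emeasure_lborel_Icc_eq)
    show "AE x in lborel. norm (indicator {c..d} x * (\<Sum>n<m. b n * rademacher (Suc n) x) ^ p)
        \<le> norm (indicator {c..d} x * (\<Sum>n<m. \<bar>b n\<bar>) ^ p)"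
      by (intro AE_I2) (auto simp: indicator_def intro: order_trans[OF bound])
  qed simp
qed

lemma integral_unit_interval_halves:
  fixes K :: "real \<Rightarrow> real"
  assumes int: "\<And>c d. integrable lborel (\<lambda>x. indicator {c..d} x * K x)"
  shows "(\<integral>x. indicator {0..1} x * K x \<partial>lborel)
    = ((\<integral>x. indicator {0..1} x * K (x / 2) \<partial>lborel)
      + (\<integral>x. indicator {0..1} x * K (1 / 2 + x / 2) \<partial>lborel)) / 2"
proof -
  have "(\<integral>x. indicator {0..1} x * K x \<partial>lborel)
    = (\<integral>x. indicator {0..1/2} x * K x + indicator {1/2..1} x * K x \<partial>lborel)"
  proof (rule integral_cong_AE)
    show "AE x in lborel. indicator {0..1} x * K x = indicator {0..1/2} x * K x + indicator {1/2..1} x * K x"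
      using AE_lborel_singleton[of "1/2 :: real"] by eventually_elim (auto simp: indicator_def)
  qed (intro borel_measurable_integrable Bochner_Integration.integrable_add int)+
  also have "\<dots> = (\<integral>x. indicator {0..1/2} x * K x \<partial>lborel) + (\<integral>x. indicator {1/2..1} x * K x \<partial>lborel)"
    by (intro Bochner_Integration.integral_add int)
  also have "(\<integral>x. indicator {0..1/2} x * K x \<partial>lborel) = 1 / 2 * (\<integral>x. indicator {0..1} x * K (x / 2) \<partial>lborel)"
  proof -
    have "indicator {0..1/2} (0 + 1 / 2 * x) = (indicator {0..1} x :: real)" for x :: real
      by (auto simp: indicator_def)
    then show ?thesis
      using lborel_integral_real_affine[of "1/2" "\<lambda>x. indicator {0..1/2} x * K x" 0] by simp
  qed
  also have "(\<integral>x. indicator {1/2..1} x * K x \<partial>lborel) = 1 / 2 * (\<integral>x. indicator {0..1} x * K (1 / 2 + x / 2) \<partial>lborel)"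
  proof -
    have "indicator {1/2..1} (1 / 2 + 1 / 2 * x) = (indicator {0..1} x :: real)" for x :: real
      by (auto simp: indicator_def)
    then show ?thesis
      using lborel_integral_real_affine[of "1/2" "\<lambda>x. indicator {1/2..1} x * K x" "1/2"] by simp
  qed
  finally show ?thesis by simp
qed

text \<open>On the unit interval the first function is 1 almost everywhere; the second is 1 on the
  left half and -1 on the right. Rescaling either half reproduces the system one step shorter, with
  \<open>b 0\<close> and \<open>b 1\<close> merged into \<open>b 0 + b 1\<close> or
  \<open>b 0 - b 1\<close>.\<close>

lemma integral_power_rademacher_aux:
  "(\<integral>x. indicator {0..1} x * (\<Sum>n<Suc m. b n * rademacher (Suc n) x) ^ p \<partial>lborel)
    = rad_mean m (\<lambda>\<epsilon>. (b 0 + rad_sum m (b \<circ> Suc) \<epsilon>) ^ p)"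
proof (induction m arbitrary: b)
  case 0
  have "(\<integral>x. indicator {0..1} x * (b 0 * rademacher (Suc 0) x) ^ p \<partial>lborel)
    = (\<integral>x. indicator {0..1::real} x * b 0 ^ p \<partial>lborel)"
  proof (rule integral_cong_AE)
    show "AE x in lborel. indicator {0..1} x * (b 0 * rademacher (Suc 0) x) ^ p = indicator {0..1::real} x * b 0 ^ p"
      using AE_lborel_singleton[of "0 :: real"] AE_lborel_singleton[of "1 :: real"]
      by eventually_elim (auto simp: indicator_def rademacher_first)
  qed auto
  then show ?case by (simp add: rad_sum_def)
next
  case (Suc m)
  define S where "S k b x = (\<Sum>n<Suc k. b n * rademacher (Suc n) x)" for k and b :: "nat \<Rightarrow> real" and x
  define b' where "b' \<sigma> = case_nat (b 0 + \<sigma> * b 1) (\<lambda>n. b (Suc (Suc n)))" for \<sigma>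
  have int: "integrable lborel (\<lambda>x. indicator {c..d} x * S k b x ^ p)" for c d k b
    unfolding S_def by (rule integrable_indicator_power_rademacher)
  have S_meas [measurable]: "S k b \<in> borel_measurable borel" for k b
    unfolding S_def[abs_def] by measurable
  have IH: "(\<integral>x. indicator {0..1} x * S m (b' \<sigma>) x ^ p \<partial>lborel)
      = rad_mean m (\<lambda>\<epsilon>. (b 0 + rad_sum (Suc m) (b \<circ> Suc) (case_nat \<sigma> \<epsilon>)) ^ p)" for \<sigma>
    unfolding S_def Suc.IH rad_sum_case_nat by (simp add: b'_def o_def algebra_simps)
  have split: "S (Suc m) b y = b 0 * rademacher (Suc 0) y + b 1 * rademacher (Suc (Suc 0)) y
      + (\<Sum>n<m. b (Suc (Suc n)) * rademacher (Suc (Suc (Suc n))) y)" for y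
    by (simp add: S_def sum.lessThan_Suc_shift del: sum.lessThan_Suc)
  have split': "S m (b' \<sigma>) x = (b 0 + \<sigma> * b 1) * rademacher (Suc 0) x
      + (\<Sum>n<m. b (Suc (Suc n)) * rademacher (Suc (Suc n)) x)" for \<sigma> x
    by (simp add: S_def b'_def sum.lessThan_Suc_shift del: sum.lessThan_Suc)
  have half: "S (Suc m) b (x / 2) = S m (b' 1) x" if "0 < x" "x < 1" for x
    using that by (simp add: split split' rademacher_half rademacher_first)
  have half_shift: "S (Suc m) b (1 / 2 + x / 2) = S m (b' (-1)) x" if "0 < x" "x < 1" for x
    using that by (simp add: split split' rademacher_half_shift rademacher_first)
  have 1: "(\<integral>x. indicator {0..1} x * S (Suc m) b (x / 2) ^ p \<partial>lborel)
      = (\<integral>x. indicator {0..1} x * S m (b' 1) x ^ p \<partial>lborel)"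
  proof (rule integral_cong_AE)
    show "AE x in lborel. indicator {0..1} x * S (Suc m) b (x / 2) ^ p = indicator {0..1} x * S m (b' 1) x ^ p"
      using AE_lborel_singleton[of "0 :: real"] AE_lborel_singleton[of "1 :: real"]
      by eventually_elim (auto simp: indicator_def half)
  qed simp_all
  have 2: "(\<integral>x. indicator {0..1} x * S (Suc m) b (1 / 2 + x / 2) ^ p \<partial>lborel)
      = (\<integral>x. indicator {0..1} x * S m (b' (-1)) x ^ p \<partial>lborel)"
  proof (rule integral_cong_AE)
    show "AE x in lborel. indicator {0..1} x * S (Suc m) b (1 / 2 + x / 2) ^ p = indicator {0..1} x * S m (b' (-1)) x ^ p"
      using AE_lborel_singleton[of "0 :: real"] AE_lborel_singleton[of "1 :: real"]
      by eventually_elim (auto simp: indicator_def half_shift)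
  qed simp_all
  have "(\<integral>x. indicator {0..1} x * S (Suc m) b x ^ p \<partial>lborel)
    = rad_mean (Suc m) (\<lambda>\<epsilon>. (b 0 + rad_sum (Suc m) (b \<circ> Suc) \<epsilon>) ^ p)"
    unfolding integral_unit_interval_halves[where K="\<lambda>x. S (Suc m) b x ^ p", OF int] 1 2 IH
    by (simp only: rad_mean_front)
  then show ?case by (simp only: S_def)
qed

lemma integral_lebesgue_on_unit:
  fixes K :: "real \<Rightarrow> real"
  assumes "K \<in> borel_measurable borel"
  shows "(\<integral>x. K x \<partial>lebesgue_on {0..1}) = (\<integral>x. indicator {0..1} x * K x \<partial>lborel)"
  using assms by (simp add: integral_restrict_space integral_completion)

lemma integral_power_rademacher:
  assumes p: "even p"
  shows "(\<integral>x. (\<Sum>n<m. b n * rademacher (Suc n) x) ^ p \<partial>lebesgue_on {0..1})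
    = rad_mean m (\<lambda>\<epsilon>. rad_sum m b \<epsilon> ^ p)"
proof (cases m)
  case 0
  have "(\<integral>x. (0::real) ^ p \<partial>lebesgue_on {0..1::real}) = 0 ^ p"
    by (subst integral_lebesgue_on_unit) auto
  then show ?thesis using 0 by (simp add: rad_sum_def)
next
  case (Suc k)
  show ?thesis
    unfolding Suc rad_mean_even_front[of "\<lambda>y. y ^ p", OF power_minus_even[OF p]]
    by (subst integral_lebesgue_on_unit) (simp_all only: integral_power_rademacher_aux, measurable)
qed

text \<open>Doubling is assumed only for \<open>Y\<close>; \<open>X\<close> inherits it through the
  two moment comparisons, with constant \<open>4 * \<beta>\<^sup>2 / \<alpha>\<^sup>2\<close>.
  \<open>A\<close> majorizes this, the doubling constant 4 of \<open>Y\<close>, and the comparison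
  constants \<open>\<beta>\<close> and \<open>1 / \<alpha>\<close>.\<close>

lemma tails_equivalent_of_moments:
  fixes X Y :: "'a \<Rightarrow> real"
  assumes M: "finite_measure M" "measure M (space M) \<le> 1"
    and X: "bdd_meas M X" and Y: "bdd_meas M Y" and \<alpha>: "0 < \<alpha>" and \<beta>: "0 < \<beta>"
    and le: "\<And>p. even p \<Longrightarrow> 0 < p \<Longrightarrow> \<alpha> ^ p * (\<integral>x. Y x ^ p \<partial>M) \<le> (\<integral>x. X x ^ p \<partial>M)"
    and ge: "\<And>p. even p \<Longrightarrow> 0 < p \<Longrightarrow> (\<integral>x. X x ^ p \<partial>M) \<le> \<beta> ^ p * (\<integral>x. Y x ^ p \<partial>M)"
    and dbl: "\<And>p. even p \<Longrightarrow> (\<integral>x. Y x ^ (2*p) \<partial>M) \<le> 4 ^ p * (\<integral>x. Y x ^ p \<partial>M)\<^sup>2"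
    and A: "A = 4 + \<beta> + 1 / \<alpha> + 4 * \<beta>\<^sup>2 / \<alpha>\<^sup>2" and z: "0 < z"
  shows "measure M {x \<in> space M. 8 * A ^ 3 * z < \<bar>Y x\<bar>} \<le> 8 * A ^ 3 * measure M {x \<in> space M. z < \<bar>X x\<bar>}"
    and "measure M {x \<in> space M. 8 * A ^ 3 * z < \<bar>X x\<bar>} \<le> 8 * A ^ 3 * measure M {x \<in> space M. z < \<bar>Y x\<bar>}"
proof -
  have pos: "0 < 1 / \<alpha>" "0 < 4 * \<beta>\<^sup>2 / \<alpha>\<^sup>2" using \<alpha> \<beta> by simp_all
  then have A1: "1 \<le> A" "4 \<le> A" "\<beta> \<le> A" "1 / \<alpha> \<le> A" "4 * \<beta>\<^sup>2 / \<alpha>\<^sup>2 \<le> A" using \<beta> by (simp_all only: A)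
  have nonneg: "0 \<le> (\<integral>x. Y x ^ p \<partial>M)" "0 \<le> (\<integral>x. X x ^ p \<partial>M)" if "even p" for p
    using that by (simp_all add: Bochner_Integration.integral_nonneg zero_le_even_power)
  have YX: "(\<integral>x. Y x ^ p \<partial>M) \<le> (1 / \<alpha>) ^ p * (\<integral>x. X x ^ p \<partial>M)" if "even p" "0 < p" for p
    using le[OF that] \<alpha> by (simp add: power_divide field_simps)
  show "measure M {x \<in> space M. 8 * A ^ 3 * z < \<bar>Y x\<bar>} \<le> 8 * A ^ 3 * measure M {x \<in> space M. z < \<bar>X x\<bar>}"
  proof (rule tail_le_of_moments_le[OF M M X Y A1(1) z])
    fix p :: nat assume p: "even p" "0 < p"
    have "(1 / \<alpha>) ^ p * (\<integral>x. X x ^ p \<partial>M) \<le> A ^ p * (\<integral>x. X x ^ p \<partial>M)"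
      using pos A1 by (intro mult_right_mono power_mono nonneg p) auto
    then show "(\<integral>x. Y x ^ p \<partial>M) \<le> A ^ p * (\<integral>x. X x ^ p \<partial>M)" using YX[OF p] by linarith
    have "(\<integral>x. X x ^ (2*p) \<partial>M) \<le> \<beta> ^ (2*p) * (\<integral>x. Y x ^ (2*p) \<partial>M)" using p by (intro ge) auto
    also have "\<dots> \<le> \<beta> ^ (2*p) * (4 ^ p * (\<integral>x. Y x ^ p \<partial>M)\<^sup>2)"
      using \<beta> by (intro mult_left_mono dbl p) auto
    also have "\<dots> \<le> \<beta> ^ (2*p) * (4 ^ p * ((1 / \<alpha>) ^ p * (\<integral>x. X x ^ p \<partial>M))\<^sup>2)"
      using \<beta> by (intro mult_left_mono power_mono YX p nonneg) auto
    also have "\<dots> = (4 * \<beta>\<^sup>2 / \<alpha>\<^sup>2) ^ p * (\<integral>x. X x ^ p \<partial>M)\<^sup>2"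
      by (simp add: power_mult power_mult_distrib power_divide power2_eq_square)
    also have "\<dots> \<le> A ^ p * (\<integral>x. X x ^ p \<partial>M)\<^sup>2"
      using pos A1 by (intro mult_right_mono power_mono) auto
    finally show "(\<integral>x. X x ^ (2*p) \<partial>M) \<le> A ^ p * (\<integral>x. X x ^ p \<partial>M)\<^sup>2" .
  qed
  show "measure M {x \<in> space M. 8 * A ^ 3 * z < \<bar>X x\<bar>} \<le> 8 * A ^ 3 * measure M {x \<in> space M. z < \<bar>Y x\<bar>}"
  proof (rule tail_le_of_moments_le[OF M M Y X A1(1) z])
    fix p :: nat assume p: "even p" "0 < p"
    have "\<beta> ^ p * (\<integral>x. Y x ^ p \<partial>M) \<le> A ^ p * (\<integral>x. Y x ^ p \<partial>M)"
      using \<beta> A1 by (intro mult_right_mono power_mono nonneg p) auto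
    then show "(\<integral>x. X x ^ p \<partial>M) \<le> A ^ p * (\<integral>x. Y x ^ p \<partial>M)" using ge[OF p] by linarith
    have "4 ^ p * (\<integral>x. Y x ^ p \<partial>M)\<^sup>2 \<le> A ^ p * (\<integral>x. Y x ^ p \<partial>M)\<^sup>2"
      using A1 by (intro mult_right_mono power_mono) auto
    then show "(\<integral>x. Y x ^ (2*p) \<partial>M) \<le> A ^ p * (\<integral>x. Y x ^ p \<partial>M)\<^sup>2" using dbl[OF p(1)] by linarith
  qed
qed

section \<open>Lebesgue measure on the unit interval and the transfer to segments\<close>

lemma tail01_eq: "tail01 h z = measure (lebesgue_on {0..1}) {x \<in> space (lebesgue_on {0..1}). z < \<bar>h x\<bar>}"
  unfolding tail01_def by (subst measure_restrict_space) auto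

lemma space_lebesgue_on_unit: "space (lebesgue_on {0..1::real}) = {0..1}"
  by (simp add: space_restrict_space)

lemma finite_measure_lebesgue_on_unit: "finite_measure (lebesgue_on {0..1::real})"
  by (intro finite_measureI) (simp add: emeasure_restrict_space)

lemma measure_lebesgue_on_unit: "measure (lebesgue_on {0..1::real}) {0..1} = 1"
  by (subst measure_restrict_space) auto

lemma set_integral_unit:
  fixes g :: "real \<Rightarrow> real"
  shows "(LINT x:{0..1}|lebesgue. g x) = (\<integral>x. g x \<partial>lebesgue_on {0..1})"
  by (simp add: set_lebesgue_integral_def integral_restrict_space)

lemma bdd_meas_rademacher: "bdd_meas (lebesgue_on {0..1}) (rademacher n)"
proof (rule bdd_measI[where B=1])
  have "rademacher n \<in> borel_measurable lborel" by measurable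
  then show "rademacher n \<in> borel_measurable (lebesgue_on {0..1})"
    by (intro measurable_restrict_space1 measurable_completion)
qed (rule abs_rademacher_le)

text \<open>The diagonal selection handles countably many sets. These suffice, since a lower bound
  for an even moment over \<open>J t\<close> passes to every larger segment. \<open>J 0\<close> is
  reserved for the whole interval, where the masses of Riesz products are measured.\<close>

lemma rational_interval_family:
  "\<exists>J :: nat \<Rightarrow> real set. J 0 = {0..1}
    \<and> (\<forall>t. \<exists>a b. 0 \<le> a \<and> a < b \<and> b \<le> 1 \<and> J t = {a..b})
    \<and> (\<forall>a b. 0 \<le> a \<longrightarrow> a < b \<longrightarrow> b \<le> 1 \<longrightarrow> (\<exists>t. J t \<subseteq> {a..b}))"
proof -
  define S where "S = {(a, b). a \<in> \<rat> \<and> b \<in> \<rat> \<and> 0 \<le> a \<and> a < b \<and> b \<le> (1 :: real)}"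
  define q where "q = from_nat_into S"
  define J where "J t = (case t of 0 \<Rightarrow> {0..1} | Suc n \<Rightarrow> {fst (q n)..snd (q n)})" for t
  have "(0, 1) \<in> S" by (auto simp: S_def)
  then have "S \<noteq> {}" by blast
  have "countable (\<rat> \<times> \<rat> :: (real \<times> real) set)" by (intro countable_SIGMA countable_rat)
  then have "countable S" by (rule countable_subset[rotated]) (auto simp: S_def)
  have q: "q n \<in> S" for n unfolding q_def by (rule from_nat_into[OF \<open>S \<noteq> {}\<close>])
  show ?thesis
  proof (intro exI[of _ J] conjI allI impI)
    show "J 0 = {0..1}" by (simp add: J_def)
    show "\<exists>a b. 0 \<le> a \<and> a < b \<and> b \<le> 1 \<and> J t = {a..b}" for t
    proof (cases t)
      case 0
      then show ?thesis by (intro exI[of _ 0] exI[of _ 1]) (simp add: J_def)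
    next
      case (Suc n)
      then show ?thesis using q[of n]
        by (intro exI[of _ "fst (q n)"] exI[of _ "snd (q n)"]) (auto simp: J_def S_def split_def)
    qed
    show "\<exists>t. J t \<subseteq> {a..b}" if ab: "0 \<le> a" "a < b" "b \<le> 1" for a b
    proof -
      obtain c where c: "c \<in> \<rat>" "a < c" "c < b" using Rats_dense_in_real[OF ab(2)] by blast
      obtain d where d: "d \<in> \<rat>" "c < d" "d < b" using Rats_dense_in_real[OF c(3)] by blast
      have "(c, d) \<in> S" using ab c d by (auto simp: S_def)
      then obtain n where "q n = (c, d)"
        using from_nat_into_surj[OF \<open>countable S\<close>] unfolding q_def by blast
      then have "J (Suc n) \<subseteq> {a..b}" using c d by (auto simp: J_def)
      then show ?thesis by blast
    qed
  qed
qed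

theorem theorem3p8:
  fixes f :: "nat \<Rightarrow> real \<Rightarrow> real" and nk :: "nat \<Rightarrow> nat" and D :: real
  assumes meas: "\<And>n. set_borel_measurable lebesgue {0..1} (f n)"
    and sub: "strict_mono nk"
    and bdd: "\<And>k x. x \<in> {0..1} \<Longrightarrow> \<bar>f (nk k) x\<bar> \<le> D"
    and weak: "\<And>g. set_borel_measurable lebesgue {0..1} g \<Longrightarrow>
                 set_integrable lebesgue {0..1} (\<lambda>x. (g x)^2) \<Longrightarrow>
                 (\<lambda>k. LINT x:{0..1}|lebesgue. f (nk k) x * g x) \<longlonglongrightarrow> 0"
    and nondeg: "\<And>F. F \<in> sets lebesgue \<Longrightarrow> F \<subseteq> {0..1} \<Longrightarrow> measure lebesgue F > 0 \<Longrightarrow>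
                 liminf (\<lambda>k. ereal (LINT x:F|lebesgue. (f (nk k) x)^2)) > 0"
  shows "\<exists>m :: nat \<Rightarrow> nat. strict_mono m \<and>
           (\<forall>a b. 0 \<le> a \<and> a < b \<and> b \<le> 1 \<longrightarrow>
              (\<exists>k0. equiv_distr (\<lambda>i x. f (m (k0 + i)) x * indicator {a..b} x)
                                 (\<lambda>i. rademacher (Suc i))))"
proof -
  let ?M = "lebesgue_on {0..1::real}"
  interpret finite_measure ?M by (rule finite_measure_lebesgue_on_unit)
  have M1: "measure ?M (space ?M) \<le> 1"
    by (simp add: space_lebesgue_on_unit measure_lebesgue_on_unit)
  from rational_interval_family obtain J :: "nat \<Rightarrow> real set" where JJ: "J 0 = {0..1}
      \<and> (\<forall>t. \<exists>a b. 0 \<le> a \<and> a < b \<and> b \<le> 1 \<and> J t = {a..b})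
      \<and> (\<forall>a b. 0 \<le> a \<longrightarrow> a < b \<longrightarrow> b \<le> 1 \<longrightarrow> (\<exists>t. J t \<subseteq> {a..b}))" ..
  from JJ have J0: "J 0 = {0..1}" by (rule conjunct1)
  from JJ have J: "\<exists>a b. 0 \<le> a \<and> a < b \<and> b \<le> 1 \<and> J t = {a..b}" for t by (elim conjE) (rule spec)
  from JJ have J_sub: "\<forall>a b. 0 \<le> a \<longrightarrow> a < b \<longrightarrow> b \<le> 1 \<longrightarrow> (\<exists>t. J t \<subseteq> {a..b})" by (elim conjE)
  have J_sets: "J t \<in> sets lebesgue" "J t \<subseteq> {0..1}" "0 < measure lebesgue (J t)" for t
    using J[of t] by auto
  have J_M: "J t \<in> sets ?M" for t
    using J_sets[of t] by (auto simp: sets_restrict_space_iff)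
  \<comment> \<open>The added 1 keeps the divisor positive when \<open>D = 0\<close>.\<close>
  define D' where "D' = \<bar>D\<bar> + 1"
  have D': "0 < D'" by (simp add: D'_def)
  define u where "u k x = f (nk k) x / D'" for k x
  have f_eq: "f (nk k) x = D' * u k x" for k x using D' by (simp add: u_def)
  have f_meas: "f n \<in> borel_measurable ?M" for n
    using meas[of n] by (simp add: set_borel_measurable_def borel_measurable_restrict_space_iff)
  have u_le: "\<bar>u k x\<bar> \<le> 1" if "x \<in> space ?M" for k x
    using bdd[of x k] that D' by (simp add: u_def D'_def space_lebesgue_on_unit)
  have u: "bdd_meas ?M (u k)" for k
  proof (rule bdd_measI[OF _ u_le])
    show "u k \<in> borel_measurable ?M"
      unfolding u_def[abs_def] by (intro borel_measurable_divide f_meas borel_measurable_const)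
  qed
  interpret bounded_weakly_null ?M u J
  proof
    show "(\<lambda>k. \<integral>x. u k x * g x \<partial>?M) \<longlonglongrightarrow> 0" if g: "bdd_meas ?M g" for g
    proof -
      have "set_borel_measurable lebesgue {0..1} g"
        using bdd_meas_measurable[OF g] by (simp add: set_borel_measurable_def borel_measurable_restrict_space_iff)
      moreover have "set_integrable lebesgue {0..1} (\<lambda>x. (g x)^2)"
        using bdd_meas_integrable[OF bdd_meas_power[OF g, of 2]]
        by (simp add: set_integrable_def integrable_restrict_space)
      ultimately have "(\<lambda>k. LINT x:{0..1}|lebesgue. f (nk k) x * g x) \<longlonglongrightarrow> 0"
        by (rule weak)
      then have "(\<lambda>k. (\<integral>x. f (nk k) x * g x \<partial>?M) / D') \<longlonglongrightarrow> 0 / D'"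
        unfolding set_integral_unit using D' by (intro tendsto_intros) auto
      then show ?thesis by (simp add: u_def)
    qed
  qed (use M1 u u_le J_M in auto)
  have nondeg': "\<exists>c>0. eventually (\<lambda>k. c \<le> (\<integral>x. (u k x)\<^sup>2 * indicator (J t) x \<partial>?M)) sequentially" for t
  proof -
    obtain c where c: "0 < ereal c" "ereal c < liminf (\<lambda>k. ereal (LINT x:J t|lebesgue. (f (nk k) x)^2))"
      using ereal_dense2[OF nondeg[OF J_sets[of t]]] by auto
    have eq: "(\<integral>x. (u k x)\<^sup>2 * indicator (J t) x \<partial>?M) = (LINT x:J t|lebesgue. (f (nk k) x)^2) / D'\<^sup>2" for k
    proof -
      have "(\<integral>x. (u k x)\<^sup>2 * indicator (J t) x \<partial>?M) = (\<integral>x. indicator {0..1} x * ((u k x)\<^sup>2 * indicator (J t) x) \<partial>lebesgue)"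
        by (simp add: integral_restrict_space)
      also have "\<dots> = (\<integral>x. (indicator (J t) x * (f (nk k) x)\<^sup>2) / D'\<^sup>2 \<partial>lebesgue)"
        using J_sets(2)[of t]
        by (intro Bochner_Integration.integral_cong refl) (auto simp: u_def indicator_def power_divide)
      finally show ?thesis by (simp add: set_lebesgue_integral_def)
    qed
    from less_LiminfD[OF c(2)]
    have "eventually (\<lambda>k. c / D'\<^sup>2 \<le> (\<integral>x. (u k x)\<^sup>2 * indicator (J t) x \<partial>?M)) sequentially"
      by eventually_elim (simp add: eq divide_right_mono)
    then show ?thesis using c D' by (intro exI[of _ "c / D'\<^sup>2"]) simp
  qed
  have "J 0 = space ?M" by (simp add: J0 space_lebesgue_on_unit)
  from exists_subsequence_moment_comparison[OF this nondeg']
  obtain s where s: "strict_mono (s :: nat \<Rightarrow> nat)"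
    and mom: "\<And>t. \<exists>k0 \<kappa>. 0 < \<kappa> \<and> (\<forall>m a p. even p \<longrightarrow> 0 < p \<longrightarrow>
      (\<integral>x. (\<Sum>i<m. a i * u (s (k0 + i)) x) ^ p \<partial>?M) \<le> 2 * rad_mean m (\<lambda>\<epsilon>. rad_sum m a \<epsilon> ^ p)
    \<and> \<kappa> ^ p * rad_mean m (\<lambda>\<epsilon>. rad_sum m a \<epsilon> ^ p)
        \<le> (\<integral>x. indicator (J t) x * (\<Sum>i<m. a i * u (s (k0 + i)) x) ^ p \<partial>?M))"
    by blast
  have "\<exists>k0. equiv_distr (\<lambda>i x. f (nk (s (k0 + i))) x * indicator {a..b} x) (\<lambda>i. rademacher (Suc i))"
    if ab: "0 \<le> a" "a < b" "b \<le> 1" for a b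
  proof -
    \<comment> \<open>The lower moment bound over \<open>J t\<close> extends to
      \<open>{a..b}\<close>, and the upper one over the whole interval restricts to it, because even
      powers are nonnegative.\<close>
    obtain t where t: "J t \<subseteq> {a..b}" using J_sub ab by blast
    obtain k0 \<kappa> where \<kappa>: "0 < \<kappa>" and mom: "\<And>m a p. even p \<Longrightarrow> 0 < p \<Longrightarrow>
        (\<integral>x. (\<Sum>i<m. a i * u (s (k0 + i)) x) ^ p \<partial>?M) \<le> 2 * rad_mean m (\<lambda>\<epsilon>. rad_sum m a \<epsilon> ^ p)
      \<and> \<kappa> ^ p * rad_mean m (\<lambda>\<epsilon>. rad_sum m a \<epsilon> ^ p)
          \<le> (\<integral>x. indicator (J t) x * (\<Sum>i<m. a i * u (s (k0 + i)) x) ^ p \<partial>?M)"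
      using mom[of t] by blast
    define \<alpha> where "\<alpha> = D' * \<kappa>"
    \<comment> \<open>The factor 2 of the upper moment bound becomes part of a p-th power because
      \<open>2 \<le> 2 ^ p\<close> for \<open>p > 0\<close>.\<close>
    define \<beta> where "\<beta> = 2 * D'"
    define A where "A = 4 + \<beta> + 1 / \<alpha> + 4 * \<beta>\<^sup>2 / \<alpha>\<^sup>2"
    have \<alpha>: "0 < \<alpha>" and \<beta>: "0 < \<beta>" using D' \<kappa> by (simp_all add: \<alpha>_def \<beta>_def)
    have "0 < A" using \<alpha> \<beta> unfolding A_def by (intro add_pos_pos) auto
    define C where "C = 8 * A ^ 3"
    have C: "0 < C" using \<open>0 < A\<close> by (simp add: C_def)
    have tails: "tail01 (\<lambda>x. \<Sum>n<m. c n * rademacher (Suc n) x) (C * z)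
          \<le> C * tail01 (\<lambda>x. \<Sum>n<m. c n * (f (nk (s (k0 + n))) x * indicator {a..b} x)) z"
        "tail01 (\<lambda>x. \<Sum>n<m. c n * (f (nk (s (k0 + n))) x * indicator {a..b} x)) (C * z)
          \<le> C * tail01 (\<lambda>x. \<Sum>n<m. c n * rademacher (Suc n) x) z" if z: "0 < z" for m c z
    proof -
      define X where "X x = (\<Sum>n<m. c n * (f (nk (s (k0 + n))) x * indicator {a..b} x))" for x
      define Y where "Y x = (\<Sum>n<m. c n * rademacher (Suc n) x)" for x
      define U where "U x = (\<Sum>n<m. c n * u (s (k0 + n)) x)" for x
      have ab_M: "{a..b} \<in> sets ?M" using ab by (auto simp: sets_restrict_space_iff)
      have U: "bdd_meas ?M U" unfolding U_def by (intro bdd_meas_intros u)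
      have X_eq: "X x = indicator {a..b} x * (D' * U x)" for x
        by (simp add: X_def U_def f_eq sum_distrib_left ac_simps)
      have X: "bdd_meas ?M X" unfolding X_eq[abs_def] by (intro bdd_meas_intros U ab_M)
      have Y: "bdd_meas ?M Y" unfolding Y_def by (intro bdd_meas_intros bdd_meas_rademacher)
      have Y_mom: "(\<integral>x. Y x ^ p \<partial>?M) = rad_mean m (\<lambda>\<epsilon>. rad_sum m c \<epsilon> ^ p)" if "even p" for p
        unfolding Y_def by (rule integral_power_rademacher[OF that])
      have X_pow: "X x ^ p = D' ^ p * (indicator {a..b} x * U x ^ p)" if "0 < p" for x p
        using that by (simp add: X_eq indicator_def power_mult_distrib)
      have le: "\<alpha> ^ p * (\<integral>x. Y x ^ p \<partial>?M) \<le> (\<integral>x. X x ^ p \<partial>?M)" if p: "even p" "0 < p" for p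
      proof -
        have "\<alpha> ^ p * (\<integral>x. Y x ^ p \<partial>?M) = D' ^ p * (\<kappa> ^ p * rad_mean m (\<lambda>\<epsilon>. rad_sum m c \<epsilon> ^ p))"
          by (simp add: Y_mom p \<alpha>_def power_mult_distrib)
        also have "\<dots> \<le> D' ^ p * (\<integral>x. indicator (J t) x * U x ^ p \<partial>?M)"
          unfolding U_def using mom[OF p, where m=m and a=c] D' by (intro mult_left_mono) auto
        also have "\<dots> \<le> D' ^ p * (\<integral>x. indicator {a..b} x * U x ^ p \<partial>?M)"
          using D' t p by (intro mult_left_mono integral_mono bdd_meas_integrable bdd_meas_intros J_M U ab_M)
            (auto simp: indicator_def zero_le_even_power)
        finally show ?thesis by (simp add: X_pow p)
      qed
      have ge: "(\<integral>x. X x ^ p \<partial>?M) \<le> \<beta> ^ p * (\<integral>x. Y x ^ p \<partial>?M)" if p: "even p" "0 < p" for p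
      proof -
        have "(\<integral>x. X x ^ p \<partial>?M) = D' ^ p * (\<integral>x. indicator {a..b} x * U x ^ p \<partial>?M)"
          by (simp add: X_pow p)
        also have "\<dots> \<le> D' ^ p * (\<integral>x. U x ^ p \<partial>?M)"
          using D' p by (intro mult_left_mono integral_mono bdd_meas_integrable bdd_meas_intros U ab_M)
            (auto simp: indicator_def zero_le_even_power)
        also have "\<dots> \<le> D' ^ p * (2 * (\<integral>x. Y x ^ p \<partial>?M))"
          unfolding U_def using mom[OF p, where m=m and a=c] D' by (intro mult_left_mono) (auto simp: Y_mom p)
        also have "\<dots> \<le> D' ^ p * (2 ^ p * (\<integral>x. Y x ^ p \<partial>?M))"
        proof (intro mult_left_mono mult_right_mono)
          show "(2::real) \<le> 2 ^ p" using power_increasing[of 1 p "2::real"] p by simp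
          show "0 \<le> (\<integral>x. Y x ^ p \<partial>?M)" using p by (intro Bochner_Integration.integral_nonneg zero_le_even_power)
        qed (use D' in simp)
        also have "\<dots> = \<beta> ^ p * (\<integral>x. Y x ^ p \<partial>?M)" by (simp add: \<beta>_def power_mult_distrib)
        finally show ?thesis .
      qed
      have dbl: "(\<integral>x. Y x ^ (2*p) \<partial>?M) \<le> 4 ^ p * (\<integral>x. Y x ^ p \<partial>?M)\<^sup>2" if "even p" for p
        using rad_mean_doubling[OF that, of m c] that by (simp add: Y_mom)
      note tl = tails_equivalent_of_moments[OF finite_measure_axioms M1 X Y \<alpha> \<beta> le ge dbl A_def z]
      show "tail01 (\<lambda>x. \<Sum>n<m. c n * rademacher (Suc n) x) (C * z)
          \<le> C * tail01 (\<lambda>x. \<Sum>n<m. c n * (f (nk (s (k0 + n))) x * indicator {a..b} x)) z"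
        using tl(1) unfolding tail01_eq C_def X_def Y_def .
      show "tail01 (\<lambda>x. \<Sum>n<m. c n * (f (nk (s (k0 + n))) x * indicator {a..b} x)) (C * z)
          \<le> C * tail01 (\<lambda>x. \<Sum>n<m. c n * rademacher (Suc n) x) z"
        using tl(2) unfolding tail01_eq C_def X_def Y_def .
    qed
    have "equiv_distr (\<lambda>i x. f (nk (s (k0 + i))) x * indicator {a..b} x) (\<lambda>i. rademacher (Suc i))"
      unfolding equiv_distr_def
    proof (intro exI[of _ C] conjI allI impI C)
      fix m and c :: "nat \<Rightarrow> real" and z :: real assume z: "0 < z"
      show "inverse C * tail01 (\<lambda>x. \<Sum>n<m. c n * (f (nk (s (k0 + n))) x * indicator {a..b} x)) (C * z)
          \<le> tail01 (\<lambda>x. \<Sum>n<m. c n * rademacher (Suc n) x) z"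
        using tails(2)[OF z, where m=m and c=c] C by (simp add: field_simps)
      have "0 < inverse C * z" "C * (inverse C * z) = z" using C z by simp_all
      then show "tail01 (\<lambda>x. \<Sum>n<m. c n * rademacher (Suc n) x) z
          \<le> C * tail01 (\<lambda>x. \<Sum>n<m. c n * (f (nk (s (k0 + n))) x * indicator {a..b} x)) (inverse C * z)"
        using tails(1)[where z="inverse C * z" and m=m and c=c] by (simp only:)
    qed
    then show ?thesis by blast
  qed
  moreover have "strict_mono (\<lambda>k. nk (s k))"
    using strict_mono_o[OF sub s] by (simp add: o_def)
  ultimately show ?thesis by (intro exI[of _ "\<lambda>k. nk (s k)"]) blast
qed

end
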